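(* Let $X$ be a trawl process with trawl function $a$, trawl set $A$ and homogeneous Lévy basis $L$ on $\mathbb{R}^2$ with Lévy seed $L'$, observed at times $0,\Delta_n,\ldots,(n-1)\Delta_n$. Assume that, as $n\uparrow\infty$, $\Delta_n\downarrow 0$ and $n\Delta_n\to+\infty$, and suppose that $\mathrm{Var}(L')=1$ and $\mathbb{E}(|L'|^4)<\infty$. Then, for all $h>0$, the statistics $$\widehat{\mathrm{Leb}(A)}=\sum_{l=0}^{n-1}\hat a(l\Delta_n)\Delta_n,\qquad \widehat{\mathrm{Leb}(A\cap A_h)}=\sum_{\substack{l\in\{0,\dots,n-1\}:\\ l\Delta_n\ge h}}\hat a(l\Delta_n)\Delta_n,\qquad \widehat{\mathrm{Leb}(A\setminus A_h)}=\sum_{\substack{l\in\{0,\dots,n-1\}:\\ l\Delta_n<h}}\hat a(l\Delta_n)\Delta_n$$ are consistent for (i.e. converge in probability as $n\to\infty$ to) $\mathrm{Leb}(A)$, $\mathrm{Leb}(A\cap A_h)$ and $\mathrm{Leb}(A\setminus A_h)$, respectively.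
   Context: A homogeneous Lévy basis $L$ on $\mathbb{R}^2$ with characteristic triplet $(\gamma,b,\nu)$ is a family of real random variables $L(B)$, indexed by Borel sets $B\subset\mathbb{R}^2$ with $\mathrm{Leb}(B)<\infty$, that is almost surely $\sigma$-additive, has $L(B)$ and $L(C)$ independent for disjoint $B,C$ (independently scattered), each $L(B)$ infinitely divisible, and $\log \mathbb{E}(e^{izL(B)})=\mathrm{Leb}(B)\psi(z)$, where $\psi(z)=i\gamma z-\frac12 b^2z^2+\int_{\mathbb{R}\setminus\{0\}}(e^{izx}-1-izx\mathbf 1_{|x|\le1})\nu(\mathrm{d}x)$, with $\gamma\in\mathbb R$, $b\ge 0$ and $\nu$ a Lévy measure. The Lévy seed $L'$ is an infinitely divisible random variable with $\log\mathbb{E}(e^{izL'})=\psi(z)$. A trawl process: let $a:[0,\infty)\to[0,\infty)$ (the trawl function) be continuous, non-increasing and integrable, let $A=\{(r,y): r\le 0,\ 0\le y\le a(-r)\}$ (the trawl set), $A_t=A+(t,0)$, and $X_t=L(A_t)$, $t\in\mathbb{R}$. $\mathrm{Leb}$ is Lebesgue measure on $\mathbb{R}^2$. Trawl function estimator: with $\bar X_n=\frac1n\sum_{k=1}^{n}X_{(k-1)\Delta_n}$ and $\hat\Gamma_l=\frac1n\sum_{k=0}^{n-1-l}(X_{(l+k)\Delta_n}-\bar X_n)(X_{k\Delta_n}-\bar X_n)$, $l=0,\dots,n-1$, and $\hat\Gamma_n=0$ (empty sum), set for $t>0$: $\hat a(t)=-\Delta_n^{-1}[\hat\Gamma_{l+1}-\hat\Gamma_l]$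 if $\Delta_n l\le t<(l+1)\Delta_n$, and $\hat a(0)=\frac{1}{2\Delta_n n}\sum_{k=0}^{n-2}(X_{(k+1)\Delta_n}-X_{k\Delta_n})^2$. *)

theory Defs
  imports "HOL-Probability.Probability"
begin

section \<open>Infinitely divisible laws and homogeneous Levy bases\<close>

definition levy_measure :: "real measure \<Rightarrow> bool" where
  "levy_measure \<nu> \<longleftrightarrow> sets \<nu> = sets borel \<and> emeasure \<nu> {0} = 0 \<and>
     (\<integral>\<^sup>+x. ennreal (min 1 (x\<^sup>2)) \<partial>\<nu>) < \<infinity>"

definition levy_exponent :: "real \<Rightarrow> real \<Rightarrow> real measure \<Rightarrow> real \<Rightarrow> complex" where
  "levy_exponent \<gamma> b \<nu> z =
     \<i> * complex_of_real (\<gamma> * z) - complex_of_real (b\<^sup>2 * z\<^sup>2 / 2) +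
     (CLINT x:-{0}|\<nu>. iexp (z * x) - 1 - \<i> * complex_of_real (z * x) * indicator {-1..1} x)"

primrec conv_power :: "real measure \<Rightarrow> nat \<Rightarrow> real measure" where
  "conv_power N 0 = return borel 0"
| "conv_power N (Suc n) = convolution N (conv_power N n)"

definition infinitely_divisible :: "real measure \<Rightarrow> bool" where
  "infinitely_divisible \<mu> \<longleftrightarrow>
     (\<forall>n\<ge>1. \<exists>N. prob_space N \<and> sets N = sets borel \<and> \<mu> = conv_power N n)"

definition finite_borel :: "(real \<times> real) set \<Rightarrow> bool" where
  "finite_borel B \<longleftrightarrow> B \<in> sets borel \<and> emeasure lborel B < \<infinity>"

text \<open>
  The relation $\log E(e^{izY}) = c\,\psi(z)$ is stated as $E(e^{izY}) = e^{c\psi(z)}$: the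
  logarithm is the distinguished one, i.e. the continuous branch vanishing at $z = 0$, and
  $c\,\psi$ is itself continuous with $\psi(0) = 0$.
\<close>

locale homogeneous_levy_basis = prob_space M
  for M :: "'a measure" and L :: "(real \<times> real) set \<Rightarrow> 'a \<Rightarrow> real"
    and \<gamma> b :: real and \<nu> :: "real measure" +
  assumes b_nonneg: "0 \<le> b"
    and levy_measure: "levy_measure \<nu>"
    and random_variable_L: "finite_borel B \<Longrightarrow> random_variable borel (L B)"
    and sigma_additive: "\<lbrakk>\<And>i::nat. finite_borel (B' i); disjoint_family B'; finite_borel (\<Union>i. B' i)\<rbrakk>
          \<Longrightarrow> AE \<omega> in M. (\<lambda>i. L (B' i) \<omega>) sums L (\<Union>i. B' i) \<omega>"
    and independently_scattered: "\<lbrakk>finite_borel B; finite_borel C; B \<inter> C = {}\<rbrakk>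
          \<Longrightarrow> indep_var borel (L B) borel (L C)"
    and infinitely_divisible_L: "finite_borel B \<Longrightarrow> infinitely_divisible (distr M borel (L B))"
    and char_L: "finite_borel B \<Longrightarrow>
          char (distr M borel (L B)) z = exp (complex_of_real (measure lborel B) * levy_exponent \<gamma> b \<nu> z)"

locale levy_seed = prob_space M'
  for M' :: "'b measure" and L' :: "'b \<Rightarrow> real" and \<gamma> b :: real and \<nu> :: "real measure" +
  assumes random_variable_seed: "random_variable borel L'"
    and infinitely_divisible_seed: "infinitely_divisible (distr M' borel L')"
    and char_seed: "char (distr M' borel L') z = exp (levy_exponent \<gamma> b \<nu> z)"


section \<open>Trawl processes\<close>

text \<open>Only the restriction of a trawl function to $[0,\infty)$ is relevant.\<close>

definition trawl_function :: "(real \<Rightarrow> real) \<Rightarrow> bool" where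
  "trawl_function a \<longleftrightarrow> (\<forall>t\<ge>0. 0 \<le> a t) \<and> continuous_on {0..} a \<and> antimono_on {0..} a \<and>
     set_integrable lborel {0..} a"

definition trawl_set :: "(real \<Rightarrow> real) \<Rightarrow> (real \<times> real) set" where
  "trawl_set a = {(r, y). r \<le> 0 \<and> 0 \<le> y \<and> y \<le> a (- r)}"

definition trawl_set_at :: "(real \<Rightarrow> real) \<Rightarrow> real \<Rightarrow> (real \<times> real) set" where
  "trawl_set_at a t = (\<lambda>p. p + (t, 0)) ` trawl_set a"

definition trawl_process ::
    "((real \<times> real) set \<Rightarrow> 'a \<Rightarrow> real) \<Rightarrow> (real \<Rightarrow> real) \<Rightarrow> real \<Rightarrow> 'a \<Rightarrow> real" where
  "trawl_process L a t = L (trawl_set_at a t)"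


section \<open>Estimators\<close>

text \<open>
  Below, \<open>X\<close> is the process, \<open>\<delta>\<close> the grid width and \<open>n\<close> the number of observations
  \<open>X 0, X \<delta>, \<dots>, X ((n - 1) * \<delta>)\<close>.
\<close>

definition sample_mean :: "(real \<Rightarrow> 'a \<Rightarrow> real) \<Rightarrow> real \<Rightarrow> nat \<Rightarrow> 'a \<Rightarrow> real" where
  "sample_mean X \<delta> n \<omega> = (1 / real n) * (\<Sum>k=1..n. X (real (k - 1) * \<delta>) \<omega>)"

text \<open>For \<open>l \<ge> n\<close> the sum is empty, so that the value at \<open>l = n\<close> is 0.\<close>

definition sample_autocov :: "(real \<Rightarrow> 'a \<Rightarrow> real) \<Rightarrow> real \<Rightarrow> nat \<Rightarrow> nat \<Rightarrow> 'a \<Rightarrow> real" where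
  "sample_autocov X \<delta> n l \<omega> = (1 / real n) *
     (\<Sum>k<n - l. (X (real (l + k) * \<delta>) \<omega> - sample_mean X \<delta> n \<omega>) *
                 (X (real k * \<delta>) \<omega> - sample_mean X \<delta> n \<omega>))"

text \<open>For \<open>\<delta> > 0\<close> and \<open>t \<ge> 0\<close>, the index \<open>l\<close> is the one with \<open>\<delta> * l \<le> t < (l + 1) * \<delta>\<close>.\<close>

definition trawl_estimator :: "(real \<Rightarrow> 'a \<Rightarrow> real) \<Rightarrow> real \<Rightarrow> nat \<Rightarrow> real \<Rightarrow> 'a \<Rightarrow> real" where
  "trawl_estimator X \<delta> n t \<omega> =
     (if t = 0
      then 1 / (2 * \<delta> * real n) * (\<Sum>k<n - 1. (X (real (k + 1) * \<delta>) \<omega> - X (real k * \<delta>) \<omega>)\<^sup>2)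
      else let l = nat \<lfloor>t / \<delta>\<rfloor>
           in - (1 / \<delta>) * (sample_autocov X \<delta> n (l + 1) \<omega> - sample_autocov X \<delta> n l \<omega>))"

definition leb_trawl_estimator :: "(real \<Rightarrow> 'a \<Rightarrow> real) \<Rightarrow> real \<Rightarrow> nat \<Rightarrow> 'a \<Rightarrow> real" where
  "leb_trawl_estimator X \<delta> n \<omega> = (\<Sum>l<n. trawl_estimator X \<delta> n (real l * \<delta>) \<omega> * \<delta>)"

definition leb_inter_estimator :: "(real \<Rightarrow> 'a \<Rightarrow> real) \<Rightarrow> real \<Rightarrow> real \<Rightarrow> nat \<Rightarrow> 'a \<Rightarrow> real" where
  "leb_inter_estimator X h \<delta> n \<omega> =
     (\<Sum>l\<in>{l. l < n \<and> h \<le> real l * \<delta>}. trawl_estimator X \<delta> n (real l * \<delta>) \<omega> * \<delta>)"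

definition leb_diff_estimator :: "(real \<Rightarrow> 'a \<Rightarrow> real) \<Rightarrow> real \<Rightarrow> real \<Rightarrow> nat \<Rightarrow> 'a \<Rightarrow> real" where
  "leb_diff_estimator X h \<delta> n \<omega> =
     (\<Sum>l\<in>{l. l < n \<and> real l * \<delta> < h}. trawl_estimator X \<delta> n (real l * \<delta>) \<omega> * \<delta>)"


section \<open>Convergence in probability to a constant\<close>

text \<open>Measurability is part of the notion, since \<open>measure\<close> is 0 on non-measurable sets.\<close>

definition tendsto_in_prob :: "'a measure \<Rightarrow> (nat \<Rightarrow> 'a \<Rightarrow> real) \<Rightarrow> real \<Rightarrow> bool" where
  "tendsto_in_prob M Y c \<longleftrightarrow> (\<forall>n. Y n \<in> borel_measurable M) \<and>
     (\<forall>\<epsilon>>0. (\<lambda>n. measure M {\<omega> \<in> space M. \<bar>Y n \<omega> - c\<bar> > \<epsilon>}) \<longlonglongrightarrow> 0)"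

end

theory Submission
  imports Defs
begin

text \<open>
  The sums that define the statistics telescope. Up to two boundary terms of order \<open>1 / n\<close>, the
  estimator of the area of \<open>A\<close> is the sample variance, and the estimator of the area of \<open>A \<inter> A\<^sub>h\<close> is
  the sample autocovariance at the first grid lag that is at least \<open>h\<close>; the third statistic is the
  difference of these two (\<open>leb_trawl_estimator_eq\<close>, \<open>leb_inter_estimator_eq\<close>,
  \<open>leb_diff_estimator_eq\<close>). The covariance of two values of the trawl process is the area of the overlap
  of their trawl sets. So it has to be shown that a sample autocovariance at a lag \<open>l\<^sub>n\<close> with
  \<open>l\<^sub>n \<Delta>\<^sub>n \<longlonglongrightarrow> s\<close> converges to the area of \<open>A \<inter> A\<^sub>s\<close>, and this is a law of large numbers in \<open>L\<^sup>2\<close>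
  (\<open>sample_autocov_tendsto_L1\<close>).

  Write \<open>S B\<close> for the square of the centred value of the Levy basis on \<open>B\<close>. A product of two centred
  values on \<open>U\<close> and \<open>V\<close> is almost surely
  \<open>(S (U \<union> V) + S (U \<inter> V) - S (U - V) - S (V - U)) / 2\<close> (\<open>centred_mult_polarization\<close>), so only
  averages of squares have to be studied. For these, the covariance of \<open>S B\<close> and \<open>S C\<close> is the variance of
  \<open>S (B \<inter> C)\<close> (\<open>expectation_squares\<close>), which is at most the fourth moment on \<open>B \<inter> C\<close>. That moment
  depends on the area only and tends to 0 with it (\<open>fourth_moment_small\<close>), since the fourth moment of
  a centred additive family is superadditive. As trawl sets at distant times have a small overlap
  (\<open>trawl_overlap_small\<close>), and most pairs of observation times are distant when the observation window
  \<open>n \<Delta>\<^sub>n\<close> grows (\<open>double_average_tendsto_0\<close>), the variance of the average vanishes.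

  Independence is assumed only for the values on two disjoint sets, not for longer families. This
  suffices for the moments of order four: applying it to unions of disjoint sets and expanding gives
  the mixed moments of three sets (\<open>expectation_square_mult_disjoint\<close>). Finiteness of the fourth moments
  is inherited from the seed (\<open>L_in_L4\<close>).
\<close>

section \<open>Random variables with a finite fourth moment\<close>

definition L4 :: "'a measure \<Rightarrow> ('a \<Rightarrow> real) set" where
  "L4 M = {Y \<in> borel_measurable M. integrable M (\<lambda>\<omega>. Y \<omega> ^ 4)}"

lemma L4_measurable: "Y \<in> L4 M \<Longrightarrow> Y \<in> borel_measurable M"
  and L4_integrable_power4: "Y \<in> L4 M \<Longrightarrow> integrable M (\<lambda>\<omega>. Y \<omega> ^ 4)"
  by (auto simp: L4_def)

lemma abs_mult4_le:
  fixes a b c d :: real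
  shows "\<bar>a * b * c * d\<bar> \<le> a ^ 4 + b ^ 4 + c ^ 4 + d ^ 4"
proof -
  have pq: "\<bar>p * q\<bar> \<le> p\<^sup>2 + q\<^sup>2" for p q :: real
  proof -
    have "0 \<le> (p - q)\<^sup>2 + p\<^sup>2 + q\<^sup>2" "0 \<le> (p + q)\<^sup>2 + p\<^sup>2 + q\<^sup>2" by auto
    then show ?thesis by (simp add: power2_diff power2_sum abs_le_iff)
  qed
  have "\<bar>a * b * c * d\<bar> = \<bar>(a * b) * (c * d)\<bar>" by (simp add: mult.assoc)
  also have "\<dots> \<le> (a * b)\<^sup>2 + (c * d)\<^sup>2" by (rule pq)
  also have "\<dots> = \<bar>a\<^sup>2 * b\<^sup>2\<bar> + \<bar>c\<^sup>2 * d\<^sup>2\<bar>" by (simp add: power_mult_distrib)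
  also have "\<dots> \<le> ((a\<^sup>2)\<^sup>2 + (b\<^sup>2)\<^sup>2) + ((c\<^sup>2)\<^sup>2 + (d\<^sup>2)\<^sup>2)"
    by (intro add_mono pq)
  finally show ?thesis by simp
qed

lemma integrable_mult4_L4:
  assumes "X \<in> L4 M" "Y \<in> L4 M" "Z \<in> L4 M" "W \<in> L4 M"
  shows "integrable M (\<lambda>\<omega>. X \<omega> * Y \<omega> * Z \<omega> * W \<omega>)"
proof (rule Bochner_Integration.integrable_bound)
  show "integrable M (\<lambda>\<omega>. X \<omega> ^ 4 + Y \<omega> ^ 4 + Z \<omega> ^ 4 + W \<omega> ^ 4)"
    using assms by (intro Bochner_Integration.integrable_add L4_integrable_power4)
  show "(\<lambda>\<omega>. X \<omega> * Y \<omega> * Z \<omega> * W \<omega>) \<in> borel_measurable M"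
    using assms by (intro borel_measurable_times L4_measurable)
  show "AE \<omega> in M. norm (X \<omega> * Y \<omega> * Z \<omega> * W \<omega>)
      \<le> norm (X \<omega> ^ 4 + Y \<omega> ^ 4 + Z \<omega> ^ 4 + W \<omega> ^ 4)"
    unfolding real_norm_def by (intro AE_I2 order_trans[OF abs_mult4_le abs_ge_self])
qed

lemma (in finite_measure) L4_const: "(\<lambda>_. c) \<in> L4 M"
  by (simp add: L4_def)

lemma (in finite_measure) L4_integrable:
  assumes "X \<in> L4 M"
  shows "integrable M X"
  using integrable_mult4_L4[OF assms L4_const[of 1] L4_const[of 1] L4_const[of 1]] by simp

lemma (in finite_measure) L4_integrable_mult:
  assumes "X \<in> L4 M" "Y \<in> L4 M"
  shows "integrable M (\<lambda>\<omega>. X \<omega> * Y \<omega>)"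
  using integrable_mult4_L4[OF assms L4_const[of 1] L4_const[of 1]] by simp

lemma (in finite_measure) L4_integrable_square:
  assumes "X \<in> L4 M"
  shows "integrable M (\<lambda>\<omega>. (X \<omega>)\<^sup>2)"
  using L4_integrable_mult[OF assms assms] by (simp add: power2_eq_square)

lemma L4_cmult:
  assumes "X \<in> L4 M"
  shows "(\<lambda>\<omega>. c * X \<omega>) \<in> L4 M"
  using assms by (auto simp: L4_def power_mult_distrib)

lemma L4_add:
  assumes "X \<in> L4 M" "Y \<in> L4 M"
  shows "(\<lambda>\<omega>. X \<omega> + Y \<omega>) \<in> L4 M"
proof -
  have "integrable M (\<lambda>\<omega>. (X \<omega> * X \<omega> * X \<omega> * X \<omega>) + 4 * (X \<omega> * X \<omega> * X \<omega> * Y \<omega>)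
      + 6 * (X \<omega> * X \<omega> * Y \<omega> * Y \<omega>) + 4 * (X \<omega> * Y \<omega> * Y \<omega> * Y \<omega>) + (Y \<omega> * Y \<omega> * Y \<omega> * Y \<omega>))"
    by (intro Bochner_Integration.integrable_add integrable_mult_right integrable_mult4_L4 assms)
  also have "(\<lambda>\<omega>. (X \<omega> * X \<omega> * X \<omega> * X \<omega>) + 4 * (X \<omega> * X \<omega> * X \<omega> * Y \<omega>)
      + 6 * (X \<omega> * X \<omega> * Y \<omega> * Y \<omega>) + 4 * (X \<omega> * Y \<omega> * Y \<omega> * Y \<omega>) + (Y \<omega> * Y \<omega> * Y \<omega> * Y \<omega>))
      = (\<lambda>\<omega>. (X \<omega> + Y \<omega>) ^ 4)"
    by (rule ext) (simp add: power4_eq_xxxx algebra_simps)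
  finally show ?thesis
    using assms by (auto simp: L4_def)
qed

lemma (in finite_measure) L4_sum:
  assumes "\<And>i. i \<in> I \<Longrightarrow> X i \<in> L4 M"
  shows "(\<lambda>\<omega>. \<Sum>i\<in>I. X i \<omega>) \<in> L4 M"
  using assms by (induction I rule: infinite_finite_induct) (auto intro: L4_const L4_add)

lemma L4_cong_AE:
  assumes "X \<in> L4 M" "Y \<in> borel_measurable M" "AE \<omega> in M. X \<omega> = Y \<omega>"
  shows "Y \<in> L4 M"
proof -
  have "integrable M (\<lambda>\<omega>. Y \<omega> ^ 4)"
    by (rule integrable_cong_AE_imp[OF L4_integrable_power4[OF assms(1)]]) (use assms in auto)
  then show ?thesis using assms by (simp add: L4_def)
qed

lemma L4_eq_distr:
  assumes "X \<in> borel_measurable M" "Y \<in> borel_measurable N" "distr M borel X = distr N borel Y"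
  shows "X \<in> L4 M \<longleftrightarrow> Y \<in> L4 N"
proof -
  have "integrable M (\<lambda>\<omega>. X \<omega> ^ 4) \<longleftrightarrow> integrable (distr M borel X) (\<lambda>x. x ^ 4)"
    using assms(1) by (simp add: integrable_distr_eq)
  also have "\<dots> \<longleftrightarrow> integrable N (\<lambda>\<omega>. Y \<omega> ^ 4)"
    unfolding assms(3) using assms(2) by (simp add: integrable_distr_eq)
  finally show ?thesis using assms(1,2) by (simp add: L4_def)
qed

text \<open>Conditioning on the value \<open>y\<close> of one summand, the sum is a translate of the other one;
  by Fubini, its fourth moment is finite for almost every \<open>y\<close>, and one such \<open>y\<close> is enough.\<close>

lemma (in prob_space) L4_indep_summand:
  assumes indep: "indep_var borel X borel Y" and "(\<lambda>\<omega>. X \<omega> + Y \<omega>) \<in> L4 M"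
  shows "X \<in> L4 M"
proof -
  have X: "X \<in> borel_measurable M" and Y: "Y \<in> borel_measurable M"
    using indep by (auto dest: indep_var_rv1 indep_var_rv2)
  interpret PX: prob_space "distr M borel X" by (rule prob_space_distr[OF X])
  interpret PY: prob_space "distr M borel Y" by (rule prob_space_distr[OF Y])
  interpret PP: pair_prob_space "distr M borel Y" "distr M borel X" ..
  interpret PQ: pair_prob_space "distr M borel X" "distr M borel Y" ..
  have "integrable M (\<lambda>\<omega>. (X \<omega> + Y \<omega>) ^ 4)"
    using assms(2) by (rule L4_integrable_power4)
  then have "integrable (distr M (borel \<Otimes>\<^sub>M borel) (\<lambda>\<omega>. (X \<omega>, Y \<omega>))) (\<lambda>p. (fst p + snd p) ^ 4)"
    using X Y by (subst integrable_distr_eq) auto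
  also have "distr M (borel \<Otimes>\<^sub>M borel) (\<lambda>\<omega>. (X \<omega>, Y \<omega>)) = distr M borel X \<Otimes>\<^sub>M distr M borel Y"
    using indep by (simp add: indep_var_distribution_eq)
  finally have I: "integrable (distr M borel X \<Otimes>\<^sub>M distr M borel Y) (\<lambda>p. (fst p + snd p) ^ 4)" .
  from PQ.integrable_product_swap[OF I]
  have "integrable (distr M borel Y \<Otimes>\<^sub>M distr M borel X) (\<lambda>(y, x). (x + y) ^ 4)"
    by (simp add: case_prod_beta)
  from PP.AE_integrable_fst'[OF this]
  have "AE y in distr M borel Y. integrable (distr M borel X) (\<lambda>x. (x + y) ^ 4)" by simp
  moreover have "\<not> (AE y in distr M borel Y. False)"
    using PY.AE_False by blast
  ultimately obtain y where "integrable (distr M borel X) (\<lambda>x. (x + y) ^ 4)"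
    using eventually_mono by (metis (mono_tags, lifting))
  then have "(\<lambda>\<omega>. X \<omega> + y) \<in> L4 M"
    using X by (simp add: L4_def integrable_distr_eq)
  from L4_add[OF this L4_const[of "- y"]] show ?thesis by simp
qed

lemma (in prob_space) indep_var_expectation_mult:
  fixes f g :: "real \<Rightarrow> real"
  assumes "indep_var borel X borel Y" "f \<in> borel_measurable borel" "g \<in> borel_measurable borel"
    and "integrable M (\<lambda>\<omega>. f (X \<omega>))" "integrable M (\<lambda>\<omega>. g (Y \<omega>))"
  shows "expectation (\<lambda>\<omega>. f (X \<omega>) * g (Y \<omega>))
    = expectation (\<lambda>\<omega>. f (X \<omega>)) * expectation (\<lambda>\<omega>. g (Y \<omega>))"
  using indep_var_lebesgue_integral[OF indep_var_compose[OF assms(1-3)]] assms(4,5)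
  by (simp add: comp_def)

text \<open>Nonnegativity makes an additive function monotone, and comparing \<open>n * c\<close> with its integer part
  leaves an error that is bounded uniformly in \<open>n\<close>.\<close>

lemma additive_nonneg_linear:
  fixes v :: "real \<Rightarrow> real"
  assumes add: "\<And>c d. 0 \<le> c \<Longrightarrow> 0 \<le> d \<Longrightarrow> v (c + d) = v c + v d"
    and nonneg: "\<And>c. 0 \<le> c \<Longrightarrow> 0 \<le> v c" and "0 \<le> c"
  shows "v c = c * v 1"
proof -
  have mult: "v (real n * d) = real n * v d" if "0 \<le> d" for n d
  proof (induction n)
    case 0
    then show ?case using add[of 0 0] by simp
  next
    case (Suc n)
    then show ?case using add[of d "real n * d"] that by (simp add: algebra_simps)
  qed
  have mono: "v p \<le> v q" if "0 \<le> p" "p \<le> q" for p q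
    using add[of p "q - p"] nonneg[of "q - p"] that by simp
  have bound: "real n * \<bar>v c - c * v 1\<bar> \<le> v 1" for n
  proof -
    define m where "m = nat \<lfloor>real n * c\<rfloor>"
    have m: "real m \<le> real n * c" "real n * c \<le> real m + 1"
      using \<open>0 \<le> c\<close> by (auto simp: m_def)
    have "real m * v 1 \<le> real n * v c"
      using mono[of "real m" "real n * c"] m mult[of 1 m] mult[of c n] \<open>0 \<le> c\<close> by simp
    moreover have "real n * v c \<le> (real m + 1) * v 1"
      using mono[of "real n * c" "real (Suc m)"] m mult[of 1 "Suc m"] mult[of c n] \<open>0 \<le> c\<close>
      by (simp add: add.commute)
    moreover have "real m * v 1 \<le> (real n * c) * v 1" "(real n * c) * v 1 \<le> (real m + 1) * v 1"
      using m nonneg[of 1] by (auto intro!: mult_right_mono)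
    ultimately have "\<bar>real n * v c - real n * c * v 1\<bar> \<le> v 1"
      by (simp add: algebra_simps)
    moreover have "\<bar>real n * v c - real n * c * v 1\<bar> = real n * \<bar>v c - c * v 1\<bar>"
      by (simp add: abs_mult mult.assoc flip: right_diff_distrib)
    ultimately show ?thesis by simp
  qed
  show ?thesis
  proof (rule ccontr)
    assume "v c \<noteq> c * v 1"
    then obtain n where "v 1 < real n * \<bar>v c - c * v 1\<bar>"
      using reals_Archimedean3[of "\<bar>v c - c * v 1\<bar>"] by auto
    then show False using bound[of n] by simp
  qed
qed

section \<open>Planar sets of finite area\<close>

lemma finite_borel_empty [simp]: "finite_borel {}"
  by (simp add: finite_borel_def)

lemma finite_borel_Un: "finite_borel B \<Longrightarrow> finite_borel C \<Longrightarrow> finite_borel (B \<union> C)"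
  unfolding finite_borel_def
  using emeasure_subadditive[of B lborel C] by (auto simp: top.not_eq_extremum ennreal_add_eq_top intro: le_less_trans)

lemma finite_borel_subset: "finite_borel B \<Longrightarrow> C \<in> sets borel \<Longrightarrow> C \<subseteq> B \<Longrightarrow> finite_borel C"
  unfolding finite_borel_def using emeasure_mono[of C B lborel] by (auto intro: le_less_trans)

lemma finite_borel_Diff: "finite_borel B \<Longrightarrow> finite_borel C \<Longrightarrow> finite_borel (B - C)"
  by (rule finite_borel_subset[of B]) (auto simp: finite_borel_def)

lemma finite_borel_Int: "finite_borel B \<Longrightarrow> finite_borel C \<Longrightarrow> finite_borel (B \<inter> C)"
  by (rule finite_borel_subset[of B]) (auto simp: finite_borel_def)

lemma finite_borel_sets [simp]: "finite_borel B \<Longrightarrow> B \<in> sets borel"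
  and finite_borel_emeasure: "finite_borel B \<Longrightarrow> emeasure lborel B \<noteq> \<infinity>"
  by (auto simp: finite_borel_def)

lemma finite_borel_fmeasurable: "finite_borel B \<Longrightarrow> B \<in> fmeasurable lborel"
  by (simp add: finite_borel_def fmeasurable_def)

lemma measure_mono_finite_borel:
  "finite_borel B \<Longrightarrow> C \<in> sets borel \<Longrightarrow> C \<subseteq> B \<Longrightarrow> measure lborel C \<le> measure lborel B"
  by (intro measure_mono_fmeasurable finite_borel_fmeasurable) auto

lemma measure_disjoint_Un:
  "finite_borel B \<Longrightarrow> finite_borel C \<Longrightarrow> B \<inter> C = {} \<Longrightarrow>
    measure lborel (B \<union> C) = measure lborel B + measure lborel C"
  by (intro measure_Union finite_borel_emeasure) auto

lemma measure_Un_le_finite_borel: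
  "finite_borel B \<Longrightarrow> finite_borel C \<Longrightarrow>
    measure lborel (B \<union> C) \<le> measure lborel B + measure lborel C"
  by (simp add: measure_Un_le)

text \<open>Since every real \<open>c \<ge> 0\<close> is the area of a strip, laws of the basis can be indexed by area.\<close>

definition strip :: "real \<Rightarrow> real \<Rightarrow> (real \<times> real) set" where
  "strip c d = {0<..1} \<times> {c<..d}"

lemma emeasure_strip: "c \<le> d \<Longrightarrow> emeasure lborel (strip c d) = ennreal (d - c)"
proof -
  have "emeasure (lborel \<Otimes>\<^sub>M lborel) ({0<..1::real} \<times> {c<..d::real})
      = emeasure lborel {0<..1::real} * emeasure lborel {c<..d}"
    by (rule lborel.emeasure_pair_measure_Times) auto
  then show "c \<le> d \<Longrightarrow> emeasure lborel (strip c d) = ennreal (d - c)"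
    by (simp add: strip_def lborel_prod)
qed

lemma finite_borel_strip [simp]: "finite_borel (strip c d)"
proof (cases "c \<le> d")
  case True
  then show ?thesis
    by (auto simp: finite_borel_def emeasure_strip) (auto simp: strip_def intro!: borel_Times)
next
  case False
  then have "strip c d = {}" by (auto simp: strip_def)
  then show ?thesis by simp
qed

lemma measure_strip: "c \<le> d \<Longrightarrow> measure lborel (strip c d) = d - c"
  by (simp add: measure_def emeasure_strip)

lemma strip_Un: "c \<le> d \<Longrightarrow> d \<le> e \<Longrightarrow> strip c d \<union> strip d e = strip c e"
  and strip_Int: "strip c d \<inter> strip d e = {}"
  by (auto simp: strip_def)

section \<open>Moments of a Levy basis\<close>

context homogeneous_levy_basis
begin

lemma L_measurable: "finite_borel B \<Longrightarrow> L B \<in> borel_measurable M"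
  using random_variable_L by simp

lemma L_empty: "AE \<omega> in M. L {} \<omega> = 0"
proof -
  have "AE \<omega> in M. (\<lambda>i::nat. L {} \<omega>) sums L (\<Union>i::nat. {}) \<omega>"
    by (rule sigma_additive) (auto simp: disjoint_family_on_def)
  then show ?thesis
    by eventually_elim (metis sums_summable summable_const_iff)
qed

lemma L_disjoint_Un:
  assumes B: "finite_borel B" and C: "finite_borel C" and "B \<inter> C = {}"
  shows "AE \<omega> in M. L (B \<union> C) \<omega> = L B \<omega> + L C \<omega>"
proof -
  define F :: "nat \<Rightarrow> (real \<times> real) set" where "F i = (if i = 0 then B else if i = 1 then C else {})" for i
  have U: "(\<Union>i. F i) = B \<union> C"
    by (auto simp: F_def split: if_splits)
  have "AE \<omega> in M. (\<lambda>i. L (F i) \<omega>) sums L (\<Union>i. F i) \<omega>"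
    using assms unfolding U[symmetric]
    by (intro sigma_additive) (auto simp: U F_def disjoint_family_on_def finite_borel_Un)
  then show ?thesis using L_empty
  proof eventually_elim
    case (elim \<omega>)
    have "(\<lambda>i. L (F i) \<omega>) sums (\<Sum>i\<in>{0,1}. L (F i) \<omega>)"
      by (rule sums_finite) (use elim in \<open>auto simp: F_def\<close>)
    then have "(\<Sum>i\<in>{0,1}. L (F i) \<omega>) = L (B \<union> C) \<omega>"
      using elim(1) unfolding U by (rule sums_unique2)
    then show ?case by (simp add: F_def)
  qed
qed

text \<open>The characteristic function of \<open>L B\<close> involves \<open>B\<close> only through its area.\<close>

lemma L_law_cong:
  assumes B: "finite_borel B" and C: "finite_borel C" and "measure lborel B = measure lborel C"
  shows "distr M borel (L B) = distr M borel (L C)"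
proof (intro Levy_uniqueness ext)
  show "real_distribution (distr M borel (L B))" "real_distribution (distr M borel (L C))"
    using B C by (auto intro!: real_distribution_distr L_measurable)
  show "char (distr M borel (L B)) z = char (distr M borel (L C)) z" for z
    using assms by (simp only: char_L)
qed

end

locale normalized_levy_basis =
  homogeneous_levy_basis M L \<gamma> b \<nu> + seed: levy_seed M' L' \<gamma> b \<nu>
  for M :: "'a measure" and L \<gamma> b \<nu> and M' :: "'b measure" and L' +
  assumes seed_fourth_moment: "integrable M' (\<lambda>\<omega>. \<bar>L' \<omega>\<bar> ^ 4)"
    and seed_variance: "seed.variance L' = 1"

context normalized_levy_basis
begin

lemma unit_strip_law: "distr M borel (L (strip 0 1)) = distr M' borel L'"
proof (intro Levy_uniqueness ext)
  show "real_distribution (distr M borel (L (strip 0 1)))"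
    by (simp add: real_distribution_distr L_measurable)
  show "real_distribution (distr M' borel L')"
    by (simp add: seed.real_distribution_distr seed.random_variable_seed)
  show "char (distr M borel (L (strip 0 1))) z = char (distr M' borel L') z" for z
    by (simp add: char_L seed.char_seed measure_strip)
qed

text \<open>The fourth moment passes from the seed to unit strips by equality of laws, from these to strips of
  integer area by summation, and from there to a strip of any smaller area, which is an independent
  summand. Every set of finite area has the same law as some strip.\<close>

lemma L_in_L4:
  assumes B: "finite_borel B"
  shows "L B \<in> L4 M"
proof -
  have "L' \<in> L4 M'"
    using seed_fourth_moment seed.random_variable_seed by (simp add: L4_def)
  then have unit: "L (strip 0 1) \<in> L4 M"
    using L4_eq_distr[OF _ _ unit_strip_law] seed.random_variable_seed L_measurable by simp
  have int: "L (strip 0 (real n)) \<in> L4 M" for n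
  proof (induction n)
    case 0
    have "strip 0 0 = {}" by (simp add: strip_def)
    moreover have "AE \<omega> in M. 0 = L {} \<omega>"
      using L_empty by eventually_elim simp
    ultimately show ?case
      using L4_cong_AE[OF L4_const[of 0], of "L {}"] L_measurable by simp
  next
    case (Suc n)
    let ?s = "strip (real n) (real (Suc n))"
    have "L ?s \<in> L4 M"
      using unit L4_eq_distr[OF _ _ L_law_cong[of "strip 0 1" ?s]]
      by (simp add: measure_strip L_measurable)
    with Suc have "(\<lambda>\<omega>. L (strip 0 (real n)) \<omega> + L ?s \<omega>) \<in> L4 M" by (rule L4_add)
    moreover have "AE \<omega> in M. L (strip 0 (real n)) \<omega> + L ?s \<omega> = L (strip 0 (real (Suc n))) \<omega>"
      using L_disjoint_Un[OF finite_borel_strip finite_borel_strip strip_Int, of 0 "real n" "real (Suc n)"]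
      unfolding strip_Un[OF of_nat_0_le_iff of_nat_mono[OF lessI[THEN less_imp_le]]]
      by eventually_elim simp
    ultimately show ?case by (blast intro: L4_cong_AE L_measurable finite_borel_strip)
  qed
  define c where "c = measure lborel B"
  obtain n where n: "c \<le> real n" using real_arch_simple by blast
  have c: "0 \<le> c" by (simp add: c_def)
  have "AE \<omega> in M. L (strip 0 (real n)) \<omega> = L (strip 0 c) \<omega> + L (strip c (real n)) \<omega>"
    using L_disjoint_Un[of "strip 0 c" "strip c (real n)"] n c by (simp add: strip_Un strip_Int)
  then have "(\<lambda>\<omega>. L (strip 0 c) \<omega> + L (strip c (real n)) \<omega>) \<in> L4 M"
    by (intro L4_cong_AE[OF int[of n]] borel_measurable_add L_measurable) auto
  then have "L (strip 0 c) \<in> L4 M"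
    by (rule L4_indep_summand[rotated]) (simp add: independently_scattered strip_Int)
  then show ?thesis
    using L4_eq_distr[OF _ _ L_law_cong[of "strip 0 c" B]] B c
    by (simp add: measure_strip L_measurable c_def)
qed

definition centred :: "(real \<times> real) set \<Rightarrow> 'a \<Rightarrow> real" where
  "centred B \<omega> = L B \<omega> - expectation (L B)"

lemma centred_in_L4: "finite_borel B \<Longrightarrow> centred B \<in> L4 M"
  using L4_add[OF L_in_L4[of B] L4_const[of "- expectation (L B)"]] by (simp add: centred_def[abs_def])

lemma centred_measurable: "finite_borel B \<Longrightarrow> centred B \<in> borel_measurable M"
  by (rule L4_measurable[OF centred_in_L4])

lemma expectation_centred: "finite_borel B \<Longrightarrow> expectation (centred B) = 0"
  using L4_integrable[OF L_in_L4[of B]] by (simp add: centred_def[abs_def] prob_space)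

lemma centred_disjoint_Un:
  assumes B: "finite_borel B" and C: "finite_borel C" and "B \<inter> C = {}"
  shows "AE \<omega> in M. centred (B \<union> C) \<omega> = centred B \<omega> + centred C \<omega>"
proof -
  have "expectation (L (B \<union> C)) = expectation (\<lambda>\<omega>. L B \<omega> + L C \<omega>)"
    by (rule integral_cong_AE)
      (use assms L_disjoint_Un[OF assms] L_measurable finite_borel_Un in auto)
  also have "\<dots> = expectation (L B) + expectation (L C)"
    using assms by (intro Bochner_Integration.integral_add L4_integrable L_in_L4)
  finally show ?thesis
    using L_disjoint_Un[OF assms] by (auto simp: centred_def)
qed

lemma centred_split:
  assumes B: "finite_borel B" and C: "finite_borel C"
  shows "AE \<omega> in M. centred B \<omega> = centred (B - C) \<omega> + centred (B \<inter> C) \<omega>"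
proof -
  have "(B - C) \<union> (B \<inter> C) = B" by auto
  then show ?thesis
    using centred_disjoint_Un[of "B - C" "B \<inter> C"] assms
    by (metis Diff_disjoint Int_Diff finite_borel_Diff finite_borel_Int inf_commute Int_assoc inf_bot_right)
qed

lemma indep_centred:
  assumes B: "finite_borel B" and C: "finite_borel C" and "B \<inter> C = {}"
  shows "indep_var borel (centred B) borel (centred C)"
  using indep_var_compose[OF independently_scattered[OF assms],
      of "\<lambda>x. x - expectation (L B)" borel "\<lambda>x. x - expectation (L C)" borel]
  by (simp add: comp_def centred_def[abs_def])

lemma centred_law_cong:
  assumes B: "finite_borel B" and C: "finite_borel C" and eq: "measure lborel B = measure lborel C"
    and f: "f \<in> borel_measurable borel"
  shows "expectation (\<lambda>\<omega>. f (centred B \<omega>)) = expectation (\<lambda>\<omega>. (f (centred C \<omega>) :: real))"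
proof -
  have e: "expectation (\<lambda>\<omega>. g (L B \<omega>)) = expectation (\<lambda>\<omega>. (g (L C \<omega>) :: real))"
    if "g \<in> borel_measurable borel" for g
  proof -
    have "expectation (\<lambda>\<omega>. g (L B \<omega>)) = integral\<^sup>L (distr M borel (L B)) g"
      using that L_measurable[OF B] by (simp add: integral_distr)
    also have "\<dots> = expectation (\<lambda>\<omega>. g (L C \<omega>))"
      unfolding L_law_cong[OF B C eq] using that L_measurable[OF C] by (simp add: integral_distr)
    finally show ?thesis .
  qed
  from e[of "\<lambda>x. x"] have "expectation (L B) = expectation (L C)" by simp
  then show ?thesis
    unfolding centred_def using e[of "\<lambda>x. f (x - expectation (L C))"] f by simp
qed

lemma mean_cong:
  assumes B: "finite_borel B" and C: "finite_borel C" and eq: "measure lborel B = measure lborel C"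
  shows "expectation (L B) = expectation (L C)"
proof -
  have "expectation (L B) = integral\<^sup>L (distr M borel (L B)) (\<lambda>x. x)"
    using L_measurable[OF B] by (simp add: integral_distr)
  also have "\<dots> = expectation (L C)"
    unfolding L_law_cong[OF B C eq] using L_measurable[OF C] by (simp add: integral_distr)
  finally show ?thesis .
qed

lemma expectation_centred_mult_disjoint:
  assumes "finite_borel B" "finite_borel C" "B \<inter> C = {}"
  shows "expectation (\<lambda>\<omega>. centred B \<omega> * centred C \<omega>) = 0"
  using indep_var_expectation_mult[OF indep_centred[OF assms], of "\<lambda>x. x" "\<lambda>x. x"]
    L4_integrable[OF centred_in_L4] assms by (simp add: expectation_centred)

text \<open>The variance is a nonnegative additive function of the area, hence linear; its slope is the
  variance of the seed.\<close>

lemma expectation_centred_square: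
  assumes B: "finite_borel B"
  shows "expectation (\<lambda>\<omega>. (centred B \<omega>)\<^sup>2) = measure lborel B"
proof -
  define v where "v c = expectation (\<lambda>\<omega>. (centred (strip 0 c) \<omega>)\<^sup>2)" for c
  have v: "expectation (\<lambda>\<omega>. (centred C \<omega>)\<^sup>2) = v (measure lborel C)" if "finite_borel C" for C
    unfolding v_def using that by (intro centred_law_cong) (auto simp: measure_strip)
  have add: "v (c + d) = v c + v d" if "0 \<le> c" "0 \<le> d" for c d
  proof -
    let ?C = "strip 0 c" and ?D = "strip c (c + d)"
    have "AE \<omega> in M. centred (strip 0 (c + d)) \<omega> = centred ?C \<omega> + centred ?D \<omega>"
      using centred_disjoint_Un[of ?C ?D] that by (simp add: strip_Un strip_Int)
    then have "v (c + d) = expectation (\<lambda>\<omega>. (centred ?C \<omega>)\<^sup>2 + 2 * (centred ?C \<omega> * centred ?D \<omega>) + (centred ?D \<omega>)\<^sup>2)"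
      unfolding v_def
      by (intro integral_cong_AE) (auto simp: power2_sum algebra_simps intro!: borel_measurable_add borel_measurable_power borel_measurable_times centred_measurable)
    also have "\<dots> = v c + v d"
      using expectation_centred_mult_disjoint[of ?C ?D] v[of ?C] v[of ?D] that
      by (simp add: L4_integrable_square L4_integrable_mult centred_in_L4 strip_Int measure_strip)
    finally show ?thesis .
  qed
  have "v 1 = seed.variance L'"
  proof -
    have m: "expectation (L (strip 0 1)) = seed.expectation L'"
    proof -
      have "expectation (L (strip 0 1)) = integral\<^sup>L (distr M borel (L (strip 0 1))) (\<lambda>x. x)"
        using L_measurable by (simp add: integral_distr)
      then show ?thesis
        unfolding unit_strip_law using seed.random_variable_seed by (simp add: integral_distr)
    qed
    have "v 1 = integral\<^sup>L (distr M borel (L (strip 0 1))) (\<lambda>x. (x - seed.expectation L')\<^sup>2)"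
      using L_measurable by (simp add: integral_distr v_def centred_def m)
    then show ?thesis
      unfolding unit_strip_law using seed.random_variable_seed by (simp add: integral_distr)
  qed
  then have "v c = c" if "0 \<le> c" for c
    using additive_nonneg_linear[of v c] add that seed_variance
    by (simp add: v_def)
  then show ?thesis using v[OF B] by simp
qed

lemma integrable_centred_mult4:
  assumes "finite_borel A" "finite_borel B" "finite_borel C" "finite_borel D"
  shows "integrable M (\<lambda>\<omega>. centred A \<omega> * centred B \<omega> * centred C \<omega> * centred D \<omega>)"
  using assms by (intro integrable_mult4_L4 centred_in_L4)

lemma expectation_squares_disjoint:
  assumes "finite_borel B" "finite_borel C" "B \<inter> C = {}"
  shows "expectation (\<lambda>\<omega>. centred B \<omega> * centred B \<omega> * centred C \<omega> * centred C \<omega>)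
    = measure lborel B * measure lborel C"
proof -
  have "expectation (\<lambda>\<omega>. (centred B \<omega>)\<^sup>2 * (centred C \<omega>)\<^sup>2) = measure lborel B * measure lborel C"
    using indep_var_expectation_mult[OF indep_centred[OF assms], of "\<lambda>x. x\<^sup>2" "\<lambda>x. x\<^sup>2"] assms
    by (simp add: L4_integrable_square centred_in_L4 expectation_centred_square)
  then show ?thesis by (simp add: power2_eq_square mult.assoc)
qed

lemma expectation_cube_mult_disjoint:
  assumes "finite_borel B" "finite_borel C" "B \<inter> C = {}"
  shows "expectation (\<lambda>\<omega>. centred B \<omega> * centred B \<omega> * centred B \<omega> * centred C \<omega>) = 0"
proof -
  have "integrable M (\<lambda>\<omega>. centred B \<omega> ^ 3)"
    using integrable_mult4_L4[OF centred_in_L4 centred_in_L4 centred_in_L4 L4_const[of 1], of B B B] assms(1)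
    by (simp add: power3_eq_cube)
  then have "expectation (\<lambda>\<omega>. centred B \<omega> ^ 3 * centred C \<omega>)
      = expectation (\<lambda>\<omega>. centred B \<omega> ^ 3) * expectation (centred C)"
    using assms by (intro indep_var_expectation_mult[OF indep_centred[OF assms]]
        L4_integrable[OF centred_in_L4[of C]]) auto
  then show ?thesis
    unfolding power3_eq_cube using assms(2) by (simp add: expectation_centred)
qed

text \<open>Independence is only available for pairs of disjoint sets. The pair \<open>P \<union> Q\<close>, \<open>D\<close> gives
  the mixed moment of three disjoint sets by polarization.\<close>

lemma expectation_square_mult_disjoint:
  assumes P: "finite_borel P" and Q: "finite_borel Q" and D: "finite_borel D"
    and disj: "P \<inter> Q = {}" "P \<inter> D = {}" "Q \<inter> D = {}"
  shows "expectation (\<lambda>\<omega>. centred P \<omega> * centred Q \<omega> * centred D \<omega> * centred D \<omega>) = 0"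
proof -
  let ?p = "centred P" and ?q = "centred Q" and ?d = "centred D"
  note int = integrable_centred_mult4[OF P P D D] integrable_centred_mult4[OF Q Q D D]
    integrable_centred_mult4[OF P Q D D]
  have PQ: "finite_borel (P \<union> Q)" using P Q by (rule finite_borel_Un)
  have [measurable]: "?p \<in> borel_measurable M" "?q \<in> borel_measurable M"
    "?d \<in> borel_measurable M" "centred (P \<union> Q) \<in> borel_measurable M"
    using P Q D PQ by (auto intro: centred_measurable)
  have "(measure lborel P + measure lborel Q) * measure lborel D
      = expectation (\<lambda>\<omega>. centred (P \<union> Q) \<omega> * centred (P \<union> Q) \<omega> * ?d \<omega> * ?d \<omega>)"
    using disj by (subst expectation_squares_disjoint[OF PQ D])
      (auto simp: measure_disjoint_Un[OF P Q])
  also have "\<dots> = expectation (\<lambda>\<omega>. ?p \<omega> * ?p \<omega> * ?d \<omega> * ?d \<omega> + ?q \<omega> * ?q \<omega> * ?d \<omega> * ?d \<omega>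
      + 2 * (?p \<omega> * ?q \<omega> * ?d \<omega> * ?d \<omega>))"
    using centred_disjoint_Un[OF P Q disj(1)]
    by (intro integral_cong_AE) (auto simp: algebra_simps)
  also have "\<dots> = measure lborel P * measure lborel D + measure lborel Q * measure lborel D
      + 2 * expectation (\<lambda>\<omega>. ?p \<omega> * ?q \<omega> * ?d \<omega> * ?d \<omega>)"
    using int P Q D disj by (simp add: expectation_squares_disjoint)
  finally show ?thesis by (simp add: algebra_simps)
qed

definition fourth_moment :: "(real \<times> real) set \<Rightarrow> real" where
  "fourth_moment B = expectation (\<lambda>\<omega>. centred B \<omega> ^ 4)"

lemma fourth_moment_nonneg: "0 \<le> fourth_moment B"
  unfolding fourth_moment_def by (intro integral_nonneg_AE) simp

text \<open>This is the covariance formula on which everything rests: the squares over \<open>B\<close> and \<open>C\<close> have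
  the covariance \<open>fourth_moment (B \<inter> C) - (measure lborel (B \<inter> C))\<^sup>2\<close>, which is the variance of the
  square over \<open>B \<inter> C\<close>. After splitting \<open>B\<close> and \<open>C\<close> along their intersection, all mixed moments
  containing an odd power vanish.\<close>

lemma expectation_squares:
  assumes B: "finite_borel B" and C: "finite_borel C"
  shows "expectation (\<lambda>\<omega>. centred B \<omega> * centred B \<omega> * centred C \<omega> * centred C \<omega>)
    = measure lborel B * measure lborel C + fourth_moment (B \<inter> C) - (measure lborel (B \<inter> C))\<^sup>2"
proof -
  define P Q D where "P = B - C" and "Q = C - B" and "D = B \<inter> C"
  have P: "finite_borel P" and Q: "finite_borel Q" and D: "finite_borel D"
    using B C by (auto simp: P_def Q_def D_def finite_borel_Diff finite_borel_Int)
  have disj: "P \<inter> Q = {}" "P \<inter> D = {}" "Q \<inter> D = {}" "D \<inter> P = {}" "D \<inter> Q = {}" "Q \<inter> P = {}" "P \<inter> C = {}"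
    by (auto simp: P_def Q_def D_def)
  let ?p = "centred P" and ?q = "centred Q" and ?d = "centred D" and ?c = "centred C"
  have [measurable]: "?p \<in> borel_measurable M" "?q \<in> borel_measurable M"
    "?d \<in> borel_measurable M" "?c \<in> borel_measurable M" "centred B \<in> borel_measurable M"
    using P Q D B C by (auto intro: centred_measurable)
  note int = integrable_centred_mult4[OF P P C C] integrable_centred_mult4[OF P D Q Q]
    integrable_centred_mult4[OF P Q D D] integrable_centred_mult4[OF D D D P]
    integrable_centred_mult4[OF D D Q Q] integrable_centred_mult4[OF D D D Q]
    integrable_centred_mult4[OF D D D D]
  have B_split: "AE \<omega> in M. centred B \<omega> = ?p \<omega> + ?d \<omega>"
    using centred_split[OF B C] by (simp add: P_def D_def)
  have C_split: "AE \<omega> in M. ?c \<omega> = ?q \<omega> + ?d \<omega>"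
    using centred_split[OF C B] by (simp add: Q_def D_def Int_commute)
  have "expectation (\<lambda>\<omega>. centred B \<omega> * centred B \<omega> * ?c \<omega> * ?c \<omega>)
    = expectation (\<lambda>\<omega>. ?p \<omega> * ?p \<omega> * ?c \<omega> * ?c \<omega> + 2 * (?p \<omega> * ?d \<omega> * ?q \<omega> * ?q \<omega>)
       + 4 * (?p \<omega> * ?q \<omega> * ?d \<omega> * ?d \<omega>) + 2 * (?d \<omega> * ?d \<omega> * ?d \<omega> * ?p \<omega>)
       + ?d \<omega> * ?d \<omega> * ?q \<omega> * ?q \<omega> + 2 * (?d \<omega> * ?d \<omega> * ?d \<omega> * ?q \<omega>) + ?d \<omega> * ?d \<omega> * ?d \<omega> * ?d \<omega>)"
  proof (intro integral_cong_AE)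
    show "AE \<omega> in M. centred B \<omega> * centred B \<omega> * ?c \<omega> * ?c \<omega>
      = ?p \<omega> * ?p \<omega> * ?c \<omega> * ?c \<omega> + 2 * (?p \<omega> * ?d \<omega> * ?q \<omega> * ?q \<omega>)
       + 4 * (?p \<omega> * ?q \<omega> * ?d \<omega> * ?d \<omega>) + 2 * (?d \<omega> * ?d \<omega> * ?d \<omega> * ?p \<omega>)
       + ?d \<omega> * ?d \<omega> * ?q \<omega> * ?q \<omega> + 2 * (?d \<omega> * ?d \<omega> * ?d \<omega> * ?q \<omega>) + ?d \<omega> * ?d \<omega> * ?d \<omega> * ?d \<omega>"
      using B_split C_split
    proof eventually_elim
      case (elim \<omega>)
      then show ?case by (simp only: elim) (simp add: algebra_simps)
    qed
  qed measurable
  also have "\<dots> = measure lborel P * measure lborel C + measure lborel D * measure lborel Q + fourth_moment D"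
    using int P Q D C disj
    by (simp add: expectation_squares_disjoint expectation_cube_mult_disjoint
        expectation_square_mult_disjoint fourth_moment_def power4_eq_xxxx)
  also have "measure lborel Q = measure lborel C - measure lborel D"
    using measure_disjoint_Un[OF Q D disj(3)] by (simp add: Q_def D_def Int_commute[of B C] Un_Diff_Int)
  also have "measure lborel P = measure lborel B - measure lborel D"
    using measure_disjoint_Un[OF P D disj(2)] by (simp add: P_def D_def Un_Diff_Int)
  finally show ?thesis
    by (simp add: D_def algebra_simps power2_eq_square)
qed

lemma expectation_centred_mult:
  assumes B: "finite_borel B" and C: "finite_borel C"
  shows "expectation (\<lambda>\<omega>. centred B \<omega> * centred C \<omega>) = measure lborel (B \<inter> C)"
proof -
  have P: "finite_borel (B - C)" and D: "finite_borel (B \<inter> C)" and Q: "finite_borel (C - B)"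
    using B C by (auto simp: finite_borel_Diff finite_borel_Int)
  let ?p = "centred (B - C)" and ?q = "centred (C - B)" and ?d = "centred (B \<inter> C)"
  have [measurable]: "?p \<in> borel_measurable M" "?q \<in> borel_measurable M" "?d \<in> borel_measurable M"
      "centred B \<in> borel_measurable M" "centred C \<in> borel_measurable M"
    using P Q D B C by (auto intro: centred_measurable)
  have "expectation (\<lambda>\<omega>. centred B \<omega> * centred C \<omega>)
    = expectation (\<lambda>\<omega>. ?p \<omega> * centred C \<omega> + ?d \<omega> * ?q \<omega> + (?d \<omega>)\<^sup>2)"
  proof (intro integral_cong_AE)
    show "AE \<omega> in M. centred B \<omega> * centred C \<omega> = ?p \<omega> * centred C \<omega> + ?d \<omega> * ?q \<omega> + (?d \<omega>)\<^sup>2"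
      using centred_split[OF B C] centred_split[OF C B] unfolding Int_commute[of C B]
    proof eventually_elim
      case (elim \<omega>)
      show ?case by (simp only: elim) (simp add: algebra_simps power2_eq_square)
    qed
  qed measurable
  also have "\<dots> = expectation (\<lambda>\<omega>. ?p \<omega> * centred C \<omega>) + expectation (\<lambda>\<omega>. ?d \<omega> * ?q \<omega>)
      + expectation (\<lambda>\<omega>. (?d \<omega>)\<^sup>2)"
    using P Q D C by (simp add: L4_integrable_mult L4_integrable_square centred_in_L4)
  also have "\<dots> = measure lborel (B \<inter> C)"
    using P Q D C
    by (subst (1 2) expectation_centred_mult_disjoint) (auto simp: expectation_centred_square)
  finally show ?thesis .
qed

text \<open>A product over two sets is a linear combination of squares, so that covariances of
  products reduce to those of squares.\<close>

lemma centred_mult_polarization: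
  assumes U: "finite_borel U" and V: "finite_borel V"
  shows "AE \<omega> in M. centred U \<omega> * centred V \<omega> =
    ((centred (U \<union> V) \<omega>)\<^sup>2 + (centred (U \<inter> V) \<omega>)\<^sup>2
      - (centred (U - V) \<omega>)\<^sup>2 - (centred (V - U) \<omega>)\<^sup>2) / 2"
proof -
  have "AE \<omega> in M. centred (U \<union> (V - U)) \<omega> = centred U \<omega> + centred (V - U) \<omega>"
    using U V by (intro centred_disjoint_Un finite_borel_Diff) auto
  then show ?thesis
    using centred_split[OF U V] centred_split[OF V U]
    unfolding Un_Diff_cancel Int_commute[of V U]
  proof eventually_elim
    case (elim \<omega>)
    show ?case by (simp only: elim) (simp add: power2_eq_square algebra_simps)
  qed
qed

text \<open>In the binomial expansion the odd mixed moments vanish and the remaining one is nonnegative.\<close>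

lemma fourth_moment_superadditive:
  assumes B: "finite_borel B" and C: "finite_borel C" and disj: "B \<inter> C = {}"
  shows "fourth_moment B + fourth_moment C \<le> fourth_moment (B \<union> C)"
proof -
  have D: "finite_borel (B \<union> C)" using B C by (rule finite_borel_Un)
  let ?p = "centred B" and ?q = "centred C"
  have [measurable]: "?p \<in> borel_measurable M" "?q \<in> borel_measurable M" "centred (B \<union> C) \<in> borel_measurable M"
    using B C D by (auto intro: centred_measurable)
  note int = integrable_centred_mult4[OF B B B B] integrable_centred_mult4[OF B B B C]
    integrable_centred_mult4[OF B B C C] integrable_centred_mult4[OF C C C B]
    integrable_centred_mult4[OF C C C C]
  have "fourth_moment (B \<union> C) = expectation (\<lambda>\<omega>. ?p \<omega> * ?p \<omega> * ?p \<omega> * ?p \<omega>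
     + 4 * (?p \<omega> * ?p \<omega> * ?p \<omega> * ?q \<omega>) + 6 * (?p \<omega> * ?p \<omega> * ?q \<omega> * ?q \<omega>)
     + 4 * (?q \<omega> * ?q \<omega> * ?q \<omega> * ?p \<omega>) + ?q \<omega> * ?q \<omega> * ?q \<omega> * ?q \<omega>)"
    unfolding fourth_moment_def
  proof (intro integral_cong_AE)
    show "AE \<omega> in M. centred (B \<union> C) \<omega> ^ 4 = ?p \<omega> * ?p \<omega> * ?p \<omega> * ?p \<omega>
     + 4 * (?p \<omega> * ?p \<omega> * ?p \<omega> * ?q \<omega>) + 6 * (?p \<omega> * ?p \<omega> * ?q \<omega> * ?q \<omega>)
     + 4 * (?q \<omega> * ?q \<omega> * ?q \<omega> * ?p \<omega>) + ?q \<omega> * ?q \<omega> * ?q \<omega> * ?q \<omega>"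
      using centred_disjoint_Un[OF assms]
    proof eventually_elim
      case (elim \<omega>)
      show ?case by (simp only: elim) (simp add: power4_eq_xxxx algebra_simps)
    qed
  qed measurable
  also have "\<dots> = fourth_moment B + 6 * (measure lborel B * measure lborel C) + fourth_moment C"
    using int B C disj
    by (simp add: expectation_squares_disjoint expectation_cube_mult_disjoint Int_commute
        fourth_moment_def power4_eq_xxxx)
  finally show ?thesis by simp
qed

lemma fourth_moment_cong:
  assumes "finite_borel B" "finite_borel C" "measure lborel B = measure lborel C"
  shows "fourth_moment B = fourth_moment C"
  unfolding fourth_moment_def using assms by (rule centred_law_cong) simp

text \<open>The fourth moment depends on the area alone and grows with it, because it is superadditive and
  nonnegative.\<close>

lemma fourth_moment_strip_mono:
  assumes "finite_borel B" "measure lborel B \<le> c"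
  shows "fourth_moment B \<le> fourth_moment (strip 0 c)"
proof -
  define m where "m = measure lborel B"
  have m: "0 \<le> m" "m \<le> c" using assms by (auto simp: m_def)
  have "fourth_moment B = fourth_moment (strip 0 m)"
    using assms m by (intro fourth_moment_cong) (auto simp: measure_strip m_def)
  also have "\<dots> \<le> fourth_moment (strip 0 m) + fourth_moment (strip m c)"
    using fourth_moment_nonneg by simp
  also have "\<dots> \<le> fourth_moment (strip 0 c)"
    using fourth_moment_superadditive[OF _ _ strip_Int, of 0 m c] m by (simp add: strip_Un)
  finally show ?thesis .
qed

text \<open>A set of area 1 contains \<open>n\<close> disjoint sets of area \<open>1 / n\<close>, whose fourth moments are equal
  and, by superadditivity, add up to at most that of the whole.\<close>

lemma fourth_moment_small:
  assumes "0 < \<epsilon>"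
  obtains \<eta> where "0 < \<eta>" "\<And>B. finite_borel B \<Longrightarrow> measure lborel B \<le> \<eta> \<Longrightarrow> fourth_moment B \<le> \<epsilon>"
proof -
  obtain n :: nat where n: "fourth_moment (strip 0 1) < real n * \<epsilon>"
    using reals_Archimedean3[OF assms] by blast
  then have "0 < n"
    using fourth_moment_nonneg[of "strip 0 1"] by (cases n) auto
  show thesis
  proof (rule that[of "1 / real n"])
    show "0 < 1 / real n" using \<open>0 < n\<close> by simp
    fix B assume B: "finite_borel B" "measure lborel B \<le> 1 / real n"
    define c where "c = 1 / real n"
    have c: "0 < c" using \<open>0 < n\<close> by (simp add: c_def)
    have "real k * fourth_moment (strip 0 c) \<le> fourth_moment (strip 0 (real k * c))" for k
    proof (induction k)
      case 0
      then show ?case using fourth_moment_nonneg by simp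
    next
      case (Suc k)
      have "fourth_moment (strip (real k * c) (real (Suc k) * c)) = fourth_moment (strip 0 c)"
        using c by (intro fourth_moment_cong) (auto simp: measure_strip algebra_simps)
      moreover have "fourth_moment (strip 0 (real k * c)) + fourth_moment (strip (real k * c) (real (Suc k) * c))
          \<le> fourth_moment (strip 0 (real (Suc k) * c))"
        using fourth_moment_superadditive[OF _ _ strip_Int, of 0 "real k * c" "real (Suc k) * c"] c
        by (simp add: strip_Un distrib_right)
      ultimately show ?case using Suc by (simp add: algebra_simps)
    qed
    from this[of n] have "real n * fourth_moment (strip 0 c) \<le> fourth_moment (strip 0 1)"
      using \<open>0 < n\<close> by (simp add: c_def)
    also note n
    finally have "fourth_moment (strip 0 c) < \<epsilon>" using \<open>0 < n\<close> by simp
    then show "fourth_moment B \<le> \<epsilon>"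
      using fourth_moment_strip_mono[OF B] by (simp add: c_def)
  qed
qed

lemma second_moment_sum_centred:
  assumes "finite I" and B: "\<And>i. i \<in> I \<Longrightarrow> finite_borel (B i)"
  shows "expectation (\<lambda>\<omega>. (\<Sum>i\<in>I. centred (B i) \<omega>)\<^sup>2) = (\<Sum>i\<in>I. \<Sum>j\<in>I. measure lborel (B i \<inter> B j))"
proof -
  have "expectation (\<lambda>\<omega>. (\<Sum>i\<in>I. centred (B i) \<omega>)\<^sup>2)
      = expectation (\<lambda>\<omega>. \<Sum>i\<in>I. \<Sum>j\<in>I. centred (B i) \<omega> * centred (B j) \<omega>)"
    by (simp add: power2_eq_square sum_product)
  also have "\<dots> = (\<Sum>i\<in>I. \<Sum>j\<in>I. expectation (\<lambda>\<omega>. centred (B i) \<omega> * centred (B j) \<omega>))"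
    using B by (simp add: Bochner_Integration.integral_sum L4_integrable_mult centred_in_L4)
  also have "\<dots> = (\<Sum>i\<in>I. \<Sum>j\<in>I. measure lborel (B i \<inter> B j))"
    using B by (simp add: expectation_centred_mult)
  finally show ?thesis .
qed

lemma second_moment_sum_centred_squares:
  assumes "finite I" and B: "\<And>i. i \<in> I \<Longrightarrow> finite_borel (B i)"
  shows "integrable M (\<lambda>\<omega>. (\<Sum>i\<in>I. (centred (B i) \<omega>)\<^sup>2 - measure lborel (B i))\<^sup>2)" (is ?int)
    and "expectation (\<lambda>\<omega>. (\<Sum>i\<in>I. (centred (B i) \<omega>)\<^sup>2 - measure lborel (B i))\<^sup>2)
      \<le> (\<Sum>i\<in>I. \<Sum>j\<in>I. fourth_moment (B i \<inter> B j))" (is ?le)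
proof -
  define g where "g i j \<omega> = centred (B i) \<omega> * centred (B i) \<omega> * centred (B j) \<omega> * centred (B j) \<omega>
     - measure lborel (B j) * (centred (B i) \<omega>)\<^sup>2 - measure lborel (B i) * (centred (B j) \<omega>)\<^sup>2
     + measure lborel (B i) * measure lborel (B j)" for i j \<omega>
  have g_int: "integrable M (g i j)" if "i \<in> I" "j \<in> I" for i j
    unfolding g_def using B that
    by (intro Bochner_Integration.integrable_add Bochner_Integration.integrable_diff integrable_mult_right
        integrable_centred_mult4 L4_integrable_square centred_in_L4) auto
  have g_E: "expectation (g i j) \<le> fourth_moment (B i \<inter> B j)" if "i \<in> I" "j \<in> I" for i j
  proof -
    have "expectation (g i j) = fourth_moment (B i \<inter> B j) - (measure lborel (B i \<inter> B j))\<^sup>2"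
      unfolding g_def using B that
      by (simp add: integrable_centred_mult4 L4_integrable_square centred_in_L4 expectation_squares
          expectation_centred_square prob_space)
    then show ?thesis by simp
  qed
  have eq: "(\<lambda>\<omega>. (\<Sum>i\<in>I. (centred (B i) \<omega>)\<^sup>2 - measure lborel (B i))\<^sup>2) = (\<lambda>\<omega>. \<Sum>i\<in>I. \<Sum>j\<in>I. g i j \<omega>)"
    unfolding power2_eq_square sum_product g_def
    by (intro ext sum.cong refl) (simp add: algebra_simps)
  show ?int unfolding eq using g_int by (intro Bochner_Integration.integrable_sum)
  show ?le unfolding eq using g_int g_E
    by (simp add: Bochner_Integration.integral_sum sum_mono)
qed

end

section \<open>Geometry of trawl sets\<close>

lemma emeasure_lborel_translation:
  fixes c :: "'a::euclidean_space"
  assumes B: "B \<in> sets borel"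
  shows "(\<lambda>p. p + c) ` B \<in> sets borel" "emeasure lborel ((\<lambda>p. p + c) ` B) = emeasure lborel B"
proof -
  have "(\<lambda>p. p + c) ` B = (\<lambda>p. p - c) -` B"
    by (force simp: image_iff)
  also have "(\<lambda>p. p - c) -` B \<in> sets borel"
    using measurable_sets[OF _ B, of "\<lambda>p. p - c" borel] by simp
  finally show C: "(\<lambda>p. p + c) ` B \<in> sets borel" .
  have "emeasure lborel ((\<lambda>p. p + c) ` B) = emeasure (distr lborel borel ((+) c)) ((\<lambda>p. p + c) ` B)"
    by (simp add: lborel_distr_plus)
  also have "\<dots> = emeasure lborel ((+) c -` ((\<lambda>p. p + c) ` B))"
    using C by (simp add: emeasure_distr)
  also have "(+) c -` ((\<lambda>p. p + c) ` B) = B"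
    by (auto simp: image_iff add.commute)
  finally show "emeasure lborel ((\<lambda>p. p + c) ` B) = emeasure lborel B" .
qed

text \<open>The overlap of two trawl sets at time distance \<open>u\<close> is a translate of the part of the trawl set
  to the left of \<open>- u\<close>. In this form it shrinks to the empty set as \<open>u\<close> grows.\<close>

definition trawl_tail :: "(real \<Rightarrow> real) \<Rightarrow> real \<Rightarrow> (real \<times> real) set" where
  "trawl_tail a u = {(r, y). r \<le> - u \<and> 0 \<le> y \<and> y \<le> a (- r)}"

definition trawl_overlap :: "(real \<Rightarrow> real) \<Rightarrow> real \<Rightarrow> real" where
  "trawl_overlap a u = measure lborel (trawl_tail a u)"

lemma trawl_overlap_nonneg: "0 \<le> trawl_overlap a u"
  by (simp add: trawl_overlap_def)

lemma trawl_tail_0: "trawl_tail a 0 = trawl_set a"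
  by (simp add: trawl_tail_def trawl_set_def)

lemma trawl_tail_antimono: "u \<le> v \<Longrightarrow> trawl_tail a v \<subseteq> trawl_tail a u"
  by (auto simp: trawl_tail_def)

lemma trawl_set_at_eq: "trawl_set_at a t = {(r, y). r \<le> t \<and> 0 \<le> y \<and> y \<le> a (t - r)}"
proof -
  have "(r, y) \<in> trawl_set_at a t \<longleftrightarrow> (r - t, y) \<in> trawl_set a" for r y
    by (force simp: trawl_set_at_def image_iff algebra_simps)
  then show ?thesis by (auto simp: trawl_set_def)
qed

context
  fixes a :: "real \<Rightarrow> real"
  assumes a: "trawl_function a"
begin

lemma trawl_tail_borel: "0 \<le> u \<Longrightarrow> trawl_tail a u \<in> sets borel"
proof -
  assume "0 \<le> u"
  have cont: "continuous_on UNIV (\<lambda>p :: real \<times> real. a (max 0 (- fst p)))"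
  proof (rule continuous_on_compose2[of "{0..}" a UNIV "\<lambda>p. max 0 (- fst p)"])
    show "continuous_on {0..} a" using a by (simp add: trawl_function_def)
    show "continuous_on UNIV (\<lambda>p :: real \<times> real. max 0 (- fst p))"
      by (intro continuous_on_max continuous_on_const continuous_on_minus continuous_on_fst continuous_on_id)
  qed auto
  have "trawl_tail a u = {p. fst p \<le> - u \<and> 0 \<le> snd p \<and> snd p \<le> a (max 0 (- fst p))}"
    using \<open>0 \<le> u\<close> by (auto simp: trawl_tail_def max_def)
  also have "closed \<dots>"
    by (intro closed_Collect_conj closed_Collect_le cont continuous_on_const continuous_on_fst
        continuous_on_snd continuous_on_id)
  finally show ?thesis by simp
qed

lemma emeasure_trawl_set_finite: "emeasure lborel (trawl_set a) < \<infinity>"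
proof -
  define f where "f x = ennreal (indicator {0..} x * a x)" for x
  have int: "integrable lborel (\<lambda>x. indicator {0..} x * a x)"
    using a by (simp add: trawl_function_def set_integrable_def)
  then have f_meas: "f \<in> borel_measurable borel"
    unfolding f_def by (auto dest: borel_measurable_integrable)
  have "emeasure lborel (trawl_set a) = (\<integral>\<^sup>+r. emeasure lborel (Pair r -` trawl_set a) \<partial>lborel)"
  proof -
    have "trawl_set a \<in> sets (lborel \<Otimes>\<^sub>M lborel)"
      unfolding lborel_prod using trawl_tail_borel[of 0] by (simp add: trawl_tail_0)
    from lborel.emeasure_pair_measure_alt[OF this] show ?thesis by (simp only: lborel_prod)
  qed
  also have "\<dots> \<le> (\<integral>\<^sup>+r. f (0 + - 1 * r) \<partial>lborel)"
  proof (intro nn_integral_mono)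
    fix r :: real
    have "Pair r -` trawl_set a = (if r \<le> 0 then {0..a (- r)} else {})"
      by (auto simp: trawl_set_def)
    then show "emeasure lborel (Pair r -` trawl_set a) \<le> f (0 + - 1 * r)"
      using a by (auto simp: f_def trawl_function_def)
  qed
  also have "\<dots> = (\<integral>\<^sup>+r. f r \<partial>lborel)"
    using nn_integral_real_affine[OF f_meas, of "-1" 0] by simp
  also have "\<dots> \<le> (\<integral>\<^sup>+r. ennreal (norm (indicator {0..} r * a r)) \<partial>lborel)"
    unfolding f_def by (intro nn_integral_mono ennreal_leI) simp
  also have "\<dots> < \<infinity>"
    using int by (simp add: integrable_iff_bounded)
  finally show ?thesis .
qed

lemma finite_borel_trawl_tail: "0 \<le> u \<Longrightarrow> finite_borel (trawl_tail a u)"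
proof (rule finite_borel_subset)
  show "finite_borel (trawl_tail a 0)"
    unfolding finite_borel_def using emeasure_trawl_set_finite trawl_tail_borel[of 0]
    by (simp add: trawl_tail_0)
qed (simp_all add: trawl_tail_borel trawl_tail_antimono)

lemma finite_borel_trawl_set_at: "finite_borel (trawl_set_at a t)"
proof -
  have "finite_borel (trawl_set a)"
    using finite_borel_trawl_tail[of 0] by (simp add: trawl_tail_0)
  then show ?thesis
    unfolding finite_borel_def trawl_set_at_def
    by (metis emeasure_lborel_translation)
qed

text \<open>As \<open>a\<close> is non-increasing, the overlap is cut out of the later trawl set by the time of the
  earlier one.\<close>

lemma trawl_set_at_Int:
  assumes "s \<le> t"
  shows "trawl_set_at a s \<inter> trawl_set_at a t = (\<lambda>p. p + (t, 0)) ` trawl_tail a (t - s)"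
proof -
  have mono: "a (t - r) \<le> a (s - r)" if "r \<le> s" for r
    using a assms that by (auto simp: trawl_function_def monotone_on_def)
  have "(r, y) \<in> (\<lambda>p. p + (t, 0)) ` trawl_tail a (t - s) \<longleftrightarrow> (r - t, y) \<in> trawl_tail a (t - s)" for r y
    by (force simp: image_iff algebra_simps)
  then have "(r, y) \<in> (\<lambda>p. p + (t, 0)) ` trawl_tail a (t - s) \<longleftrightarrow> r \<le> s \<and> 0 \<le> y \<and> y \<le> a (t - r)" for r y
    by (simp add: trawl_tail_def)
  moreover have "(r, y) \<in> trawl_set_at a s \<inter> trawl_set_at a t \<longleftrightarrow> r \<le> s \<and> 0 \<le> y \<and> y \<le> a (t - r)" for r y
    using assms mono[of r] by (auto simp: trawl_set_at_eq)
  ultimately show ?thesis by (intro set_eqI) (simp only: split_paired_all)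
qed

lemma measure_trawl_set_at_Int:
  "measure lborel (trawl_set_at a s \<inter> trawl_set_at a t) = trawl_overlap a \<bar>t - s\<bar>"
proof -
  have *: "measure lborel (trawl_set_at a s \<inter> trawl_set_at a t) = trawl_overlap a (t - s)" if "s \<le> t" for s t
    using emeasure_lborel_translation(2)[OF trawl_tail_borel[of "t - s"]] that
    by (simp add: trawl_set_at_Int trawl_overlap_def measure_def)
  show ?thesis
  proof (cases "s \<le> t")
    case True
    then show ?thesis using *[of s t] by simp
  next
    case False
    then show ?thesis using *[of t s] by (simp add: Int_commute[of "trawl_set_at a s"])
  qed
qed

lemma measure_trawl_set_at: "measure lborel (trawl_set_at a t) = trawl_overlap a 0"
  using measure_trawl_set_at_Int[of t t] by simp

lemma trawl_overlap_antimono: "0 \<le> u \<Longrightarrow> u \<le> v \<Longrightarrow> trawl_overlap a v \<le> trawl_overlap a u"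
  unfolding trawl_overlap_def
  by (intro measure_mono_finite_borel finite_borel_trawl_tail trawl_tail_antimono trawl_tail_borel) auto

lemma trawl_overlap_small:
  assumes "0 < \<epsilon>"
  obtains T where "0 \<le> T" "\<And>u. T \<le> u \<Longrightarrow> trawl_overlap a u < \<epsilon>"
proof -
  have "(\<lambda>n. measure lborel (trawl_tail a (real n))) \<longlonglongrightarrow> measure lborel (\<Inter>n. trawl_tail a (real n))"
  proof (rule Lim_measure_decseq)
    show "range (\<lambda>n. trawl_tail a (real n)) \<subseteq> sets lborel"
      by (simp add: image_subset_iff trawl_tail_borel)
    show "decseq (\<lambda>n. trawl_tail a (real n))"
      unfolding decseq_def by (intro allI impI trawl_tail_antimono) simp
    show "emeasure lborel (trawl_tail a (real n)) \<noteq> \<infinity>" for n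
      by (intro finite_borel_emeasure finite_borel_trawl_tail) simp
  qed
  moreover have "(\<Inter>n. trawl_tail a (real n)) = {}"
  proof -
    have "(r, y) \<notin> (\<Inter>n. trawl_tail a (real n))" for r y
    proof -
      obtain n where "- r < real n" using reals_Archimedean2 by blast
      then have "(r, y) \<notin> trawl_tail a (real n)" by (simp add: trawl_tail_def)
      then show ?thesis by blast
    qed
    then show ?thesis by (metis surj_pair equals0I)
  qed
  ultimately have "(\<lambda>n. trawl_overlap a (real n)) \<longlonglongrightarrow> 0"
    by (simp add: trawl_overlap_def)
  then have "eventually (\<lambda>n. trawl_overlap a (real n) < \<epsilon>) sequentially"
    using assms by (rule order_tendstoD)
  then obtain n where "trawl_overlap a (real n) < \<epsilon>"
    by (auto simp: eventually_sequentially)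
  then show thesis
    using that[of "real n"] trawl_overlap_antimono[of "real n"] by (meson of_nat_0_le_iff le_less_trans)
qed

text \<open>What the tail loses between \<open>u\<close> and \<open>v\<close> fits into a box of width \<open>v - u\<close> and height \<open>a 0\<close>.\<close>

lemma trawl_overlap_lipschitz:
  assumes "0 \<le> u" "u \<le> v"
  shows "trawl_overlap a u \<le> trawl_overlap a v + (v - u) * a 0"
proof -
  have a0: "0 \<le> a 0" using a by (simp add: trawl_function_def)
  define R where "R = {- v..- u} \<times> {0..a 0}"
  have "emeasure (lborel \<Otimes>\<^sub>M lborel) R = emeasure lborel {- v..- u} * emeasure lborel {0..a 0}"
    unfolding R_def by (rule lborel.emeasure_pair_measure_Times) auto
  then have R_e: "emeasure lborel R = ennreal ((v - u) * a 0)"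
    using assms a0 by (simp add: lborel_prod ennreal_mult)
  have R: "finite_borel R"
    using R_e by (auto simp: finite_borel_def R_def intro!: borel_Times)
  have "trawl_tail a u \<subseteq> trawl_tail a v \<union> R"
  proof -
    have "a (- r) \<le> a 0" if "r \<le> - u" for r
      using a assms that by (auto simp: trawl_function_def monotone_on_def)
    then show ?thesis by (force simp: trawl_tail_def R_def)
  qed
  then have "trawl_overlap a u \<le> measure lborel (trawl_tail a v \<union> R)"
    unfolding trawl_overlap_def using R assms
    by (intro measure_mono_finite_borel finite_borel_Un finite_borel_trawl_tail trawl_tail_borel) auto
  also have "\<dots> \<le> trawl_overlap a v + measure lborel R"
    unfolding trawl_overlap_def using R assms
    by (intro measure_Un_le_finite_borel finite_borel_trawl_tail) auto
  also have "measure lborel R = (v - u) * a 0"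
    using R_e assms a0 by (simp add: measure_def)
  finally show ?thesis .
qed

lemma trawl_overlap_tendsto:
  assumes "\<And>n. 0 \<le> u n" "u \<longlonglongrightarrow> s"
  shows "(\<lambda>n. trawl_overlap a (u n)) \<longlonglongrightarrow> trawl_overlap a s"
proof -
  have "0 \<le> s" using assms(2) by (rule LIMSEQ_le_const) (use assms(1) in auto)
  have bound: "\<bar>trawl_overlap a v - trawl_overlap a w\<bar> \<le> \<bar>v - w\<bar> * a 0" if "0 \<le> v" "0 \<le> w" for v w
    using trawl_overlap_lipschitz[of v w] trawl_overlap_lipschitz[of w v]
      trawl_overlap_antimono[of v w] trawl_overlap_antimono[of w v] that
    by (cases "v \<le> w") auto
  have "(\<lambda>n. \<bar>u n - s\<bar> * a 0) \<longlonglongrightarrow> \<bar>s - s\<bar> * a 0"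
    by (intro tendsto_intros assms(2))
  then have "(\<lambda>n. \<bar>u n - s\<bar> * a 0) \<longlonglongrightarrow> 0" by simp
  then have "(\<lambda>n. trawl_overlap a (u n) - trawl_overlap a s) \<longlonglongrightarrow> 0"
    by (rule tendsto_0_le[where K = 1]) (use bound assms(1) \<open>0 \<le> s\<close> in \<open>auto intro!: always_eventually order_trans[OF bound]\<close>)
  then show ?thesis by (simp add: LIM_zero_iff)
qed

end

section \<open>Averages of asymptotically diagonal arrays\<close>

lemma card_near_index_le:
  assumes "0 \<le> w"
  shows "real (card {k \<in> {..<n}. \<bar>real j - real k\<bar> < w}) \<le> 2 * w + 1"
proof -
  define m where "m = nat \<lfloor>w\<rfloor>"
  \<comment> \<open>For \<open>j < m\<close> the subtraction is truncated, which only shortens the interval.\<close>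
  have "{k \<in> {..<n}. \<bar>real j - real k\<bar> < w} \<subseteq> {j - m..j + m}"
    by (auto simp: m_def) linarith+
  then have "card {k \<in> {..<n}. \<bar>real j - real k\<bar> < w} \<le> card {j - m..j + m}"
    by (intro card_mono) auto
  also have "\<dots> \<le> 2 * m + 1" by simp
  finally have "real (card {k \<in> {..<n}. \<bar>real j - real k\<bar> < w}) \<le> 2 * real m + 1" by linarith
  also have "real m \<le> w" using assms by (simp add: m_def)
  finally show ?thesis by simp
qed

text \<open>Among the pairs of observation times, those closer than \<open>T\<close> have a proportion of order
  \<open>T / (n * \<delta> n) + 1 / n\<close>. This is where the observation window \<open>n * \<delta> n\<close> has to grow: it makes the
  near pairs negligible, while the far pairs have small entries.\<close>

lemma double_average_tendsto_0:
  fixes c :: "nat \<Rightarrow> nat \<Rightarrow> nat \<Rightarrow> real" and \<delta> :: "nat \<Rightarrow> real"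
  assumes pos: "\<And>n. 0 < \<delta> n" and long: "filterlim (\<lambda>n. real n * \<delta> n) at_top sequentially"
    and nonneg: "\<And>n j k. 0 \<le> c n j k" and bound: "\<And>n j k. c n j k \<le> K"
    and decay: "\<And>\<epsilon>. 0 < \<epsilon> \<Longrightarrow> \<exists>T\<ge>0. \<forall>n j k. T \<le> \<bar>real j - real k\<bar> * \<delta> n \<longrightarrow> c n j k \<le> \<epsilon>"
  shows "(\<lambda>n. (\<Sum>j<n. \<Sum>k<n. c n j k) / (real n)\<^sup>2) \<longlonglongrightarrow> 0"
proof (rule LIMSEQ_I)
  fix e :: real
  assume "0 < e"
  have K: "0 \<le> K" using order_trans[OF nonneg bound] .
  obtain T where T: "0 \<le> T" "\<And>n j k. T \<le> \<bar>real j - real k\<bar> * \<delta> n \<Longrightarrow> c n j k \<le> e / 2"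
    using decay[of "e / 2"] \<open>0 < e\<close> by auto
  have le: "(\<Sum>j<n. \<Sum>k<n. c n j k) / (real n)\<^sup>2
      \<le> e / 2 + K * (2 * T * inverse (real n * \<delta> n) + inverse (real n))" if "0 < n" for n
  proof -
    have row: "(\<Sum>k<n. c n j k) \<le> real n * (e / 2) + K * (2 * (T / \<delta> n) + 1)" for j
    proof -
      let ?near = "{k \<in> {..<n}. \<bar>real j - real k\<bar> < T / \<delta> n}"
      have "(\<Sum>k<n. c n j k) \<le> (\<Sum>k<n. e / 2 + (if k \<in> ?near then K else 0))"
      proof (rule sum_mono)
        fix k assume k: "k \<in> {..<n}"
        show "c n j k \<le> e / 2 + (if k \<in> ?near then K else 0)"
        proof (cases "k \<in> ?near")
          case True
          then show ?thesis using bound[of n j k] \<open>0 < e\<close> by simp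
        next
          case False
          then have "T \<le> \<bar>real j - real k\<bar> * \<delta> n"
            using k pos[of n] by (simp add: field_simps)
          then have "c n j k \<le> e / 2" by (rule T(2))
          then show ?thesis using False by (simp only: if_False)
        qed
      qed
      also have "\<dots> = real n * (e / 2) + (\<Sum>k<n. if k \<in> ?near then K else 0)"
        by (simp add: sum.distrib)
      also have "(\<Sum>k<n. if k \<in> ?near then K else 0) = (\<Sum>k\<in>?near. K)"
        by (rule sum.mono_neutral_cong_right) auto
      also have "\<dots> = K * real (card ?near)" by simp
      also have "\<dots> \<le> K * (2 * (T / \<delta> n) + 1)"
        using T(1) pos[of n] K by (intro mult_left_mono card_near_index_le) auto
      finally show ?thesis by simp
    qed
    have "(\<Sum>j<n. \<Sum>k<n. c n j k) \<le> (\<Sum>j<n. real n * (e / 2) + K * (2 * (T / \<delta> n) + 1))"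
      by (intro sum_mono row)
    also have "\<dots> = (real n)\<^sup>2 * (e / 2 + K * (2 * T * inverse (real n * \<delta> n) + inverse (real n)))"
      using that pos[of n] by (simp add: field_simps power2_eq_square)
    finally show ?thesis
      using that by (simp add: field_simps)
  qed
  have "(\<lambda>n. K * (2 * T * inverse (real n * \<delta> n) + inverse (real n))) \<longlonglongrightarrow> K * (2 * T * 0 + 0)"
    by (intro tendsto_intros tendsto_inverse_0_at_top[OF long] LIMSEQ_inverse_real_of_nat_add lim_inverse_n)
  then have "(\<lambda>n. K * (2 * T * inverse (real n * \<delta> n) + inverse (real n))) \<longlonglongrightarrow> 0" by simp
  then have "eventually (\<lambda>n. K * (2 * T * inverse (real n * \<delta> n) + inverse (real n)) < e / 2) sequentially"
    using \<open>0 < e\<close> by (intro order_tendstoD) auto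
  then have "eventually (\<lambda>n. norm ((\<Sum>j<n. \<Sum>k<n. c n j k) / (real n)\<^sup>2 - 0) < e) sequentially"
    using eventually_gt_at_top[of 0]
  proof eventually_elim
    case (elim n)
    have "0 \<le> (\<Sum>j<n. \<Sum>k<n. c n j k) / (real n)\<^sup>2"
      by (intro divide_nonneg_nonneg sum_nonneg nonneg) auto
    then show ?case using le[of n] elim by simp
  qed
  then show "\<exists>no. \<forall>n\<ge>no. norm ((\<Sum>j<n. \<Sum>k<n. c n j k) / (real n)\<^sup>2 - 0) < e"
    by (simp add: eventually_sequentially)
qed

section \<open>Convergence in mean to a constant\<close>

context prob_space
begin

text \<open>Convergence in mean, rather than in probability, is used for the intermediate terms: it is stable
  under sums by the triangle inequality, and for it a product of two factors that vanish in \<open>L\<^sup>2\<close>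
  vanishes.\<close>

definition tendsto_L1 :: "(nat \<Rightarrow> 'a \<Rightarrow> real) \<Rightarrow> real \<Rightarrow> bool" where
  "tendsto_L1 Y c \<longleftrightarrow> (\<forall>n. integrable M (Y n)) \<and> (\<lambda>n. expectation (\<lambda>\<omega>. \<bar>Y n \<omega> - c\<bar>)) \<longlonglongrightarrow> 0"

lemma tendsto_L1_integrable: "tendsto_L1 Y c \<Longrightarrow> integrable M (Y n)"
  by (simp add: tendsto_L1_def)

lemma tendsto_L1_zeroI:
  assumes meas: "\<And>n. Y n \<in> borel_measurable M" and int: "\<And>n. integrable M (V n)"
    and le: "\<And>n \<omega>. \<bar>Y n \<omega>\<bar> \<le> V n \<omega>" and lim: "(\<lambda>n. expectation (V n)) \<longlonglongrightarrow> 0"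
  shows "tendsto_L1 Y 0"
proof -
  have Y_int: "integrable M (Y n)" for n
    by (rule Bochner_Integration.integrable_bound[OF int[of n] meas])
      (use le in \<open>auto intro!: AE_I2 order_trans[OF le]\<close>)
  have "(\<lambda>n. expectation (\<lambda>\<omega>. \<bar>Y n \<omega>\<bar>)) \<longlonglongrightarrow> 0"
  proof (rule tendsto_sandwich[OF _ _ tendsto_const lim])
    show "eventually (\<lambda>n. 0 \<le> expectation (\<lambda>\<omega>. \<bar>Y n \<omega>\<bar>)) sequentially"
      by (intro always_eventually allI integral_nonneg_AE) simp
    show "eventually (\<lambda>n. expectation (\<lambda>\<omega>. \<bar>Y n \<omega>\<bar>) \<le> expectation (V n)) sequentially"
      using Y_int int le by (intro always_eventually allI integral_mono) auto
  qed
  then show ?thesis using Y_int by (simp add: tendsto_L1_def)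
qed

lemma tendsto_L1_add:
  assumes "tendsto_L1 Y c" "tendsto_L1 Z d"
  shows "tendsto_L1 (\<lambda>n \<omega>. Y n \<omega> + Z n \<omega>) (c + d)"
proof -
  note int = assms[THEN tendsto_L1_integrable]
  have "tendsto_L1 (\<lambda>n \<omega>. (Y n \<omega> + Z n \<omega>) - (c + d)) 0"
  proof (rule tendsto_L1_zeroI)
    show "(\<lambda>\<omega>. Y n \<omega> + Z n \<omega> - (c + d)) \<in> borel_measurable M" for n
      using int[of n] by (auto dest!: borel_measurable_integrable)
    show "integrable M (\<lambda>\<omega>. \<bar>Y n \<omega> - c\<bar> + \<bar>Z n \<omega> - d\<bar>)" for n
      using int[of n] by simp
    show "(\<lambda>n. expectation (\<lambda>\<omega>. \<bar>Y n \<omega> - c\<bar> + \<bar>Z n \<omega> - d\<bar>)) \<longlonglongrightarrow> 0"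
      using assms int tendsto_add[of "\<lambda>n. expectation (\<lambda>\<omega>. \<bar>Y n \<omega> - c\<bar>)" 0 sequentially
          "\<lambda>n. expectation (\<lambda>\<omega>. \<bar>Z n \<omega> - d\<bar>)" 0]
      by (simp add: tendsto_L1_def)
  qed linarith
  then show ?thesis using int by (simp add: tendsto_L1_def)
qed

lemma tendsto_L1_cmult:
  assumes "tendsto_L1 Y c"
  shows "tendsto_L1 (\<lambda>n \<omega>. r * Y n \<omega>) (r * c)"
proof -
  have "(\<lambda>n. \<bar>r\<bar> * expectation (\<lambda>\<omega>. \<bar>Y n \<omega> - c\<bar>)) \<longlonglongrightarrow> \<bar>r\<bar> * 0"
    using assms by (intro tendsto_intros) (simp add: tendsto_L1_def)
  moreover have "\<bar>r * Y n \<omega> - r * c\<bar> = \<bar>r\<bar> * \<bar>Y n \<omega> - c\<bar>" for n \<omega>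
    by (simp add: abs_mult flip: right_diff_distrib)
  ultimately show ?thesis
    using assms by (simp add: tendsto_L1_def)
qed

lemma tendsto_L1_diff:
  assumes "tendsto_L1 Y c" "tendsto_L1 Z d"
  shows "tendsto_L1 (\<lambda>n \<omega>. Y n \<omega> - Z n \<omega>) (c - d)"
  using tendsto_L1_add[OF assms(1) tendsto_L1_cmult[OF assms(2), of "-1"]] by simp

lemma tendsto_L1_deterministic:
  assumes "c \<longlonglongrightarrow> d"
  shows "tendsto_L1 (\<lambda>n \<omega>. c n) d"
  using tendsto_rabs_zero[OF LIM_zero[OF assms]] by (simp add: tendsto_L1_def prob_space)

lemma tendsto_L1_cong_AE:
  assumes "tendsto_L1 Y c" and meas: "\<And>n. Z n \<in> borel_measurable M" and eq: "\<And>n. AE \<omega> in M. Y n \<omega> = Z n \<omega>"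
  shows "tendsto_L1 Z c"
proof -
  note int = assms(1)[THEN tendsto_L1_integrable]
  have Y: "Y n \<in> borel_measurable M" for n
    using int[of n] by auto
  have "integrable M (Z n)" for n
    by (rule integrable_cong_AE_imp[OF int meas]) (use eq[of n] in auto)
  moreover have "expectation (\<lambda>\<omega>. \<bar>Y n \<omega> - c\<bar>) = expectation (\<lambda>\<omega>. \<bar>Z n \<omega> - c\<bar>)" for n
    by (rule integral_cong_AE) (use Y[of n] meas[of n] eq[of n] in auto)
  ultimately show ?thesis using assms(1) by (simp add: tendsto_L1_def)
qed

lemma tendsto_L1_zero_mult:
  assumes "\<And>n. Y n \<in> borel_measurable M" "\<And>n. Z n \<in> borel_measurable M"
    and "\<And>n. integrable M (\<lambda>\<omega>. (Y n \<omega>)\<^sup>2)" "\<And>n. integrable M (\<lambda>\<omega>. (Z n \<omega>)\<^sup>2)"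
    and "(\<lambda>n. expectation (\<lambda>\<omega>. (Y n \<omega>)\<^sup>2)) \<longlonglongrightarrow> 0" "(\<lambda>n. expectation (\<lambda>\<omega>. (Z n \<omega>)\<^sup>2)) \<longlonglongrightarrow> 0"
  shows "tendsto_L1 (\<lambda>n \<omega>. Y n \<omega> * Z n \<omega>) 0"
proof (rule tendsto_L1_zeroI)
  show "integrable M (\<lambda>\<omega>. (Y n \<omega>)\<^sup>2 + (Z n \<omega>)\<^sup>2)" for n
    using assms by simp
  show "(\<lambda>n. expectation (\<lambda>\<omega>. (Y n \<omega>)\<^sup>2 + (Z n \<omega>)\<^sup>2)) \<longlonglongrightarrow> 0"
    using tendsto_add[OF assms(5,6)] assms(3,4) by simp
  show "(\<lambda>\<omega>. Y n \<omega> * Z n \<omega>) \<in> borel_measurable M" for n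
    using assms by simp
  show "\<bar>Y n \<omega> * Z n \<omega>\<bar> \<le> (Y n \<omega>)\<^sup>2 + (Z n \<omega>)\<^sup>2" for n \<omega>
  proof -
    have "0 \<le> (Y n \<omega> - Z n \<omega>)\<^sup>2 + (Y n \<omega>)\<^sup>2 + (Z n \<omega>)\<^sup>2" "0 \<le> (Y n \<omega> + Z n \<omega>)\<^sup>2 + (Y n \<omega>)\<^sup>2 + (Z n \<omega>)\<^sup>2" by auto
    then show ?thesis by (simp add: power2_diff power2_sum abs_le_iff)
  qed
qed

lemma tendsto_L1_zero_if_L2:
  assumes meas: "\<And>n. Y n \<in> borel_measurable M" and int: "\<And>n. integrable M (\<lambda>\<omega>. (Y n \<omega>)\<^sup>2)"
    and lim: "(\<lambda>n. expectation (\<lambda>\<omega>. (Y n \<omega>)\<^sup>2)) \<longlonglongrightarrow> 0"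
  shows "tendsto_L1 Y 0"
proof -
  have Y: "integrable M (Y n)" for n
    by (rule square_integrable_imp_integrable[OF meas int])
  have le: "(expectation (\<lambda>\<omega>. \<bar>Y n \<omega>\<bar>))\<^sup>2 \<le> expectation (\<lambda>\<omega>. (Y n \<omega>)\<^sup>2)" for n
    using variance_positive[of "\<lambda>\<omega>. \<bar>Y n \<omega>\<bar>"] variance_eq[of "\<lambda>\<omega>. \<bar>Y n \<omega>\<bar>"] Y[of n] int[of n] by simp
  have "(\<lambda>n. (expectation (\<lambda>\<omega>. \<bar>Y n \<omega>\<bar>))\<^sup>2) \<longlonglongrightarrow> 0"
    by (rule tendsto_sandwich[OF _ _ tendsto_const lim]) (auto intro!: always_eventually le)
  from tendsto_real_sqrt[OF this] show ?thesis
    using Y by (simp add: tendsto_L1_def)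
qed

lemma tendsto_L1_imp_in_prob:
  assumes "tendsto_L1 Y c"
  shows "tendsto_in_prob M Y c"
  unfolding tendsto_in_prob_def
proof (intro conjI allI impI)
  note int = assms[THEN tendsto_L1_integrable]
  show meas: "Y n \<in> borel_measurable M" for n using int[of n] by auto
  fix \<epsilon> :: real
  assume "0 < \<epsilon>"
  have le: "prob {\<omega> \<in> space M. \<bar>Y n \<omega> - c\<bar> > \<epsilon>} \<le> expectation (\<lambda>\<omega>. \<bar>Y n \<omega> - c\<bar>) / \<epsilon>" for n
  proof -
    have "prob {\<omega> \<in> space M. \<bar>Y n \<omega> - c\<bar> > \<epsilon>} \<le> prob {\<omega> \<in> space M. \<bar>Y n \<omega> - c\<bar> \<ge> \<epsilon>}"
      using meas[of n] by (intro finite_measure_mono) auto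
    also have "\<dots> \<le> expectation (\<lambda>\<omega>. \<bar>Y n \<omega> - c\<bar>) / \<epsilon>"
      using int[of n] \<open>0 < \<epsilon>\<close> by (intro integral_Markov_inequality_measure[where A = "{}"]) auto
    finally show ?thesis .
  qed
  have "(\<lambda>n. expectation (\<lambda>\<omega>. \<bar>Y n \<omega> - c\<bar>) / \<epsilon>) \<longlonglongrightarrow> 0 / \<epsilon>"
    using assms \<open>0 < \<epsilon>\<close> by (intro tendsto_intros) (auto simp: tendsto_L1_def)
  then have lim: "(\<lambda>n. expectation (\<lambda>\<omega>. \<bar>Y n \<omega> - c\<bar>) / \<epsilon>) \<longlonglongrightarrow> 0" by simp
  show "(\<lambda>n. prob {\<omega> \<in> space M. \<bar>Y n \<omega> - c\<bar> > \<epsilon>}) \<longlonglongrightarrow> 0"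
    by (rule tendsto_sandwich[OF _ _ tendsto_const lim]) (auto intro!: always_eventually le)
qed

end

section \<open>Laws of large numbers for a sampled trawl process\<close>

locale sampled_trawl = normalized_levy_basis M L \<gamma> b \<nu> M' L'
  for M :: "'a measure" and L \<gamma> b \<nu> and M' :: "'b measure" and L' +
  fixes a :: "real \<Rightarrow> real" and \<Delta> :: "nat \<Rightarrow> real"
  assumes trawl: "trawl_function a"
    and width_pos: "\<And>n. 0 < \<Delta> n" and width_lim: "\<Delta> \<longlonglongrightarrow> 0"
    and long_range: "filterlim (\<lambda>n. real n * \<Delta> n) at_top sequentially"
begin

definition centred_trawl :: "real \<Rightarrow> 'a \<Rightarrow> real" where
  "centred_trawl t = centred (trawl_set_at a t)"

lemma centred_trawl_in_L4: "centred_trawl t \<in> L4 M"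
  unfolding centred_trawl_def by (intro centred_in_L4 finite_borel_trawl_set_at trawl)

lemma trawl_process_eq: "trawl_process L a = (\<lambda>t \<omega>. centred_trawl t \<omega> + expectation (L (trawl_set_at a 0)))"
proof (intro ext)
  fix t \<omega>
  have "expectation (L (trawl_set_at a t)) = expectation (L (trawl_set_at a 0))"
    by (intro mean_cong finite_borel_trawl_set_at trawl) (simp add: measure_trawl_set_at[OF trawl])
  then show "trawl_process L a t \<omega> = centred_trawl t \<omega> + expectation (L (trawl_set_at a 0))"
    by (simp add: trawl_process_def centred_trawl_def centred_def)
qed

lemma average_measurable: "(\<lambda>\<omega>. (\<Sum>k<m. centred_trawl (t k) \<omega>) / c) \<in> borel_measurable M"
  by (intro borel_measurable_divide borel_measurable_sum L4_measurable[OF centred_trawl_in_L4]) simp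

lemma average_square_integrable: "integrable M (\<lambda>\<omega>. ((\<Sum>k<m. centred_trawl (t k) \<omega>) / c)\<^sup>2)"
proof -
  have "(\<lambda>\<omega>. inverse c * (\<Sum>k<m. centred_trawl (t k) \<omega>)) \<in> L4 M"
    by (intro L4_cmult L4_sum centred_trawl_in_L4)
  from L4_integrable_square[OF this] show ?thesis by (simp add: field_simps)
qed

text \<open>The covariance of two values is the overlap at their time distance, wherever the window of the
  average starts. Covariances are nonnegative, so a shorter window only lowers the second moment of
  the sum.\<close>

lemma average_tendsto_L2:
  assumes N: "\<And>n. N n \<le> n"
  shows "(\<lambda>n. expectation (\<lambda>\<omega>. ((\<Sum>k<N n. centred_trawl (real (l n + k) * \<Delta> n) \<omega>) / real n)\<^sup>2)) \<longlonglongrightarrow> 0"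
proof -
  define c where "c n j k = trawl_overlap a (\<bar>real j - real k\<bar> * \<Delta> n)" for n j k :: nat
  have lim: "(\<lambda>n. (\<Sum>j<n. \<Sum>k<n. c n j k) / (real n)\<^sup>2) \<longlonglongrightarrow> 0"
  proof (rule double_average_tendsto_0[OF width_pos long_range])
    show "0 \<le> c n j k" for n j k by (simp add: c_def trawl_overlap_nonneg)
    show "c n j k \<le> trawl_overlap a 0" for n j k
      unfolding c_def using width_pos[of n] by (intro trawl_overlap_antimono[OF trawl]) auto
    show "\<exists>T\<ge>0. \<forall>n j k. T \<le> \<bar>real j - real k\<bar> * \<Delta> n \<longrightarrow> c n j k \<le> \<epsilon>" if "0 < \<epsilon>" for \<epsilon>
      unfolding c_def using trawl_overlap_small[OF trawl that] by (metis less_imp_le)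
  qed
  have le: "expectation (\<lambda>\<omega>. ((\<Sum>k<N n. centred_trawl (real (l n + k) * \<Delta> n) \<omega>) / real n)\<^sup>2)
      \<le> (\<Sum>j<n. \<Sum>k<n. c n j k) / (real n)\<^sup>2" for n
  proof -
    have "expectation (\<lambda>\<omega>. ((\<Sum>k<N n. centred_trawl (real (l n + k) * \<Delta> n) \<omega>) / real n)\<^sup>2)
      = expectation (\<lambda>\<omega>. (\<Sum>k<N n. centred_trawl (real (l n + k) * \<Delta> n) \<omega>)\<^sup>2) / (real n)\<^sup>2"
      by (simp add: power_divide)
    also have "expectation (\<lambda>\<omega>. (\<Sum>k<N n. centred_trawl (real (l n + k) * \<Delta> n) \<omega>)\<^sup>2)
      = (\<Sum>j<N n. \<Sum>k<N n. c n j k)"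
      unfolding centred_trawl_def
    proof (subst second_moment_sum_centred)
      show "(\<Sum>i<N n. \<Sum>j<N n. measure lborel (trawl_set_at a (real (l n + i) * \<Delta> n)
          \<inter> trawl_set_at a (real (l n + j) * \<Delta> n))) = (\<Sum>j<N n. \<Sum>k<N n. c n j k)"
      proof (intro sum.cong refl)
        fix i j
        have "real (l n + j) * \<Delta> n - real (l n + i) * \<Delta> n = (real j - real i) * \<Delta> n"
          by (simp add: algebra_simps)
        then show "measure lborel (trawl_set_at a (real (l n + i) * \<Delta> n)
          \<inter> trawl_set_at a (real (l n + j) * \<Delta> n)) = c n i j"
          using width_pos[of n]
          by (simp add: measure_trawl_set_at_Int[OF trawl] c_def abs_mult abs_minus_commute)
      qed
    qed (simp_all add: finite_borel_trawl_set_at[OF trawl])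
    also have "(\<Sum>j<N n. \<Sum>k<N n. c n j k) \<le> (\<Sum>j<n. \<Sum>k<n. c n j k)"
      using N[of n] trawl_overlap_nonneg unfolding c_def
      by (intro order_trans[OF sum_mono sum_mono2] sum_mono2 sum_nonneg) auto
    finally show ?thesis by (simp add: divide_right_mono)
  qed
  show ?thesis
    by (rule tendsto_sandwich[OF _ _ tendsto_const lim];
        intro always_eventually allI le integral_nonneg_AE AE_I2 zero_le_power2)
qed

text \<open>Sets \<open>B n j\<close> and \<open>B n k\<close> that are built from two trawl sets each, at a bounded time lag, overlap
  in a small area once their base times are far apart. The covariance of their squares is then small
  as well.\<close>

lemma squares_average_tendsto_L1:
  assumes N: "\<And>n. N n \<le> n" and B: "\<And>n k. finite_borel (B n k)"
    and sub: "\<And>n k. B n k \<subseteq> trawl_set_at a (real k * \<Delta> n) \<union> trawl_set_at a (real (l n + k) * \<Delta> n)"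
    and lag: "\<And>n. real (l n) * \<Delta> n \<le> H"
  shows "tendsto_L1 (\<lambda>n \<omega>. (\<Sum>k<N n. (centred (B n k) \<omega>)\<^sup>2 - measure lborel (B n k)) / real n) 0"
proof -
  define A where "A n k = trawl_set_at a (real k * \<Delta> n)" for n k :: nat
  have A: "finite_borel (A n k)" for n k
    by (simp add: A_def finite_borel_trawl_set_at[OF trawl])
  have AI: "measure lborel (A n j \<inter> A n k) = trawl_overlap a (\<bar>real j - real k\<bar> * \<Delta> n)" for n j k
  proof -
    have "real k * \<Delta> n - real j * \<Delta> n = (real k - real j) * \<Delta> n" by (simp add: algebra_simps)
    then show ?thesis
      using width_pos[of n]
      by (simp add: A_def measure_trawl_set_at_Int[OF trawl] abs_mult abs_minus_commute)
  qed
  define c where "c n j k = fourth_moment (B n j \<inter> B n k)" for n j k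
  have meas: "(\<lambda>\<omega>. (\<Sum>k<N n. (centred (B n k) \<omega>)\<^sup>2 - measure lborel (B n k)) / real n) \<in> borel_measurable M" for n
    using B by (intro borel_measurable_divide borel_measurable_sum borel_measurable_diff
        borel_measurable_power centred_measurable borel_measurable_const)
  note squares = second_moment_sum_centred_squares[OF finite_lessThan, of "N n" "B n" for n]
  have lim: "(\<lambda>n. (\<Sum>j<n. \<Sum>k<n. c n j k) / (real n)\<^sup>2) \<longlonglongrightarrow> 0"
  proof (rule double_average_tendsto_0[OF width_pos long_range])
    show "0 \<le> c n j k" for n j k by (simp add: c_def fourth_moment_nonneg)
    show "c n j k \<le> fourth_moment (strip 0 (2 * trawl_overlap a 0))" for n j k
      unfolding c_def
    proof (rule fourth_moment_strip_mono)
      show "finite_borel (B n j \<inter> B n k)" using B by (simp add: finite_borel_Int)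
      have "measure lborel (B n j \<inter> B n k) \<le> measure lborel (A n j \<union> A n (l n + j))"
        using sub[of n j] B by (intro measure_mono_finite_borel finite_borel_Un A) (auto simp: A_def)
      also have "\<dots> \<le> measure lborel (A n j) + measure lborel (A n (l n + j))"
        by (intro measure_Un_le_finite_borel A)
      finally show "measure lborel (B n j \<inter> B n k) \<le> 2 * trawl_overlap a 0"
        by (simp add: A_def measure_trawl_set_at[OF trawl])
    qed
    fix \<epsilon> :: real
    assume "0 < \<epsilon>"
    then obtain \<eta> where \<eta>: "0 < \<eta>" "\<And>B. finite_borel B \<Longrightarrow> measure lborel B \<le> \<eta> \<Longrightarrow> fourth_moment B \<le> \<epsilon>"
      using fourth_moment_small by blast
    then obtain T where T: "0 \<le> T" "\<And>u. T \<le> u \<Longrightarrow> trawl_overlap a u < \<eta> / 4"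
      using trawl_overlap_small[OF trawl, of "\<eta> / 4"] by auto
    have "0 \<le> H" using lag[of 0] width_pos[of 0] by (smt (verit) mult_nonneg_nonneg of_nat_0_le_iff)
    \<comment> \<open>A common lag of at most \<open>H\<close> may shift either time, so a distance \<open>T + H\<close> of the base times
      leaves at least \<open>T\<close> between a trawl set of the first and one of the second.\<close>
    have "c n j k \<le> \<epsilon>" if far: "T + H \<le> \<bar>real j - real k\<bar> * \<Delta> n" for n j k
      unfolding c_def
    proof (rule \<eta>(2))
      show "finite_borel (B n j \<inter> B n k)" using B by (simp add: finite_borel_Int)
      have small: "measure lborel (A n j' \<inter> A n k') \<le> \<eta> / 4"
        if "\<bar>real j - real k\<bar> \<le> \<bar>real j' - real k'\<bar> + real (l n)" for j' k'
      proof -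
        have "\<bar>real j - real k\<bar> * \<Delta> n \<le> (\<bar>real j' - real k'\<bar> + real (l n)) * \<Delta> n"
          using that width_pos[of n] by (intro mult_right_mono) auto
        then have "T \<le> \<bar>real j' - real k'\<bar> * \<Delta> n"
          using far lag[of n] by (simp add: distrib_right)
        then show ?thesis using T(2) by (simp add: AI less_imp_le)
      qed
      let ?U1 = "A n j \<inter> A n k" and ?U2 = "A n j \<inter> A n (l n + k)"
        and ?U3 = "A n (l n + j) \<inter> A n k" and ?U4 = "A n (l n + j) \<inter> A n (l n + k)"
      note U = finite_borel_Int[OF A A]
      have "measure lborel (B n j \<inter> B n k) \<le> measure lborel ((?U1 \<union> ?U2) \<union> (?U3 \<union> ?U4))"
        using sub[of n j] sub[of n k] B
        by (intro measure_mono_finite_borel finite_borel_Un U) (auto simp: A_def)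
      also have "\<dots> \<le> measure lborel (?U1 \<union> ?U2) + measure lborel (?U3 \<union> ?U4)"
        by (intro measure_Un_le_finite_borel finite_borel_Un U)
      also have "\<dots> \<le> (measure lborel ?U1 + measure lborel ?U2) + (measure lborel ?U3 + measure lborel ?U4)"
        by (intro add_mono measure_Un_le_finite_borel U)
      also have "\<dots> \<le> (\<eta> / 4 + \<eta> / 4) + (\<eta> / 4 + \<eta> / 4)"
        by (intro add_mono small) auto
      finally show "measure lborel (B n j \<inter> B n k) \<le> \<eta>" by simp
    qed
    then show "\<exists>T\<ge>0. \<forall>n j k. T \<le> \<bar>real j - real k\<bar> * \<Delta> n \<longrightarrow> c n j k \<le> \<epsilon>"
      using T(1) \<open>0 \<le> H\<close> by (intro exI[of _ "T + H"]) auto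
  qed
  show ?thesis
  proof (rule tendsto_L1_zero_if_L2[OF meas])
    show "integrable M (\<lambda>\<omega>. ((\<Sum>k<N n. (centred (B n k) \<omega>)\<^sup>2 - measure lborel (B n k)) / real n)\<^sup>2)" for n
      using squares(1)[OF B] by (simp add: power_divide)
    have le: "expectation (\<lambda>\<omega>. ((\<Sum>k<N n. (centred (B n k) \<omega>)\<^sup>2 - measure lborel (B n k)) / real n)\<^sup>2)
        \<le> (\<Sum>j<n. \<Sum>k<n. c n j k) / (real n)\<^sup>2" for n
    proof -
      have "expectation (\<lambda>\<omega>. (\<Sum>k<N n. (centred (B n k) \<omega>)\<^sup>2 - measure lborel (B n k))\<^sup>2)
          \<le> (\<Sum>j<N n. \<Sum>k<N n. c n j k)"
        unfolding c_def by (rule squares(2)[OF B])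
      also have "\<dots> \<le> (\<Sum>j<n. \<Sum>k<n. c n j k)"
        using N[of n] fourth_moment_nonneg unfolding c_def
        by (intro order_trans[OF sum_mono sum_mono2] sum_mono2 sum_nonneg) auto
      finally show ?thesis by (simp add: power_divide divide_right_mono)
    qed
    show "(\<lambda>n. expectation (\<lambda>\<omega>. ((\<Sum>k<N n. (centred (B n k) \<omega>)\<^sup>2 - measure lborel (B n k)) / real n)\<^sup>2)) \<longlonglongrightarrow> 0"
      by (rule tendsto_sandwich[OF _ _ tendsto_const lim];
          intro always_eventually allI le integral_nonneg_AE AE_I2 zero_le_power2)
  qed
qed

text \<open>Polarization turns a product of two values into four squares, over the union, the intersection
  and the two differences of the trawl sets, to which the law of large numbers for squares applies.\<close>

lemma products_average_tendsto_L1: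
  assumes N: "\<And>n. N n \<le> n" and lag: "\<And>n. real (l n) * \<Delta> n \<le> H"
  shows "tendsto_L1 (\<lambda>n \<omega>. (\<Sum>k<N n. centred_trawl (real (l n + k) * \<Delta> n) \<omega> * centred_trawl (real k * \<Delta> n) \<omega>
    - trawl_overlap a (real (l n) * \<Delta> n)) / real n) 0"
proof -
  define U V where "U n k = trawl_set_at a (real k * \<Delta> n)"
    and "V n k = trawl_set_at a (real (l n + k) * \<Delta> n)" for n k
  have U: "finite_borel (U n k)" and V: "finite_borel (V n k)" for n k
    by (simp_all add: U_def V_def finite_borel_trawl_set_at[OF trawl])
  have UV: "measure lborel (U n k \<inter> V n k) = trawl_overlap a (real (l n) * \<Delta> n)" for n k
    using width_pos[of n] by (simp add: U_def V_def measure_trawl_set_at_Int[OF trawl] algebra_simps)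
  define S where "S B \<omega> = (centred B \<omega>)\<^sup>2 - measure lborel B" for B \<omega>
  have S_lim: "tendsto_L1 (\<lambda>n \<omega>. (\<Sum>k<N n. S (B n k) \<omega>) / real n) 0"
    if "\<And>n k. finite_borel (B n k)" "\<And>n k. B n k \<subseteq> U n k \<union> V n k" for B
    unfolding S_def using that by (intro squares_average_tendsto_L1[OF N _ _ lag]) (auto simp: U_def V_def)
  have "tendsto_L1 (\<lambda>n \<omega>. 1/2 *
     ((\<Sum>k<N n. S (U n k \<union> V n k) \<omega>) / real n + (\<Sum>k<N n. S (U n k \<inter> V n k) \<omega>) / real n
      - (\<Sum>k<N n. S (U n k - V n k) \<omega>) / real n - (\<Sum>k<N n. S (V n k - U n k) \<omega>) / real n))
     (1/2 * (0 + 0 - 0 - 0))"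
    using U V by (intro tendsto_L1_cmult tendsto_L1_add tendsto_L1_diff S_lim)
      (auto intro: finite_borel_Un finite_borel_Int finite_borel_Diff)
  then have lim: "tendsto_L1 (\<lambda>n \<omega>. (\<Sum>k<N n. (S (U n k \<union> V n k) \<omega> + S (U n k \<inter> V n k) \<omega>
      - S (U n k - V n k) \<omega> - S (V n k - U n k) \<omega>) / 2) / real n) 0"
    by (simp add: sum.distrib sum_subtractf add_divide_distrib diff_divide_distrib mult.commute
        flip: sum_divide_distrib)
  show ?thesis
  proof (rule tendsto_L1_cong_AE[OF lim])
    fix n
    show "(\<lambda>\<omega>. (\<Sum>k<N n. centred_trawl (real (l n + k) * \<Delta> n) \<omega> * centred_trawl (real k * \<Delta> n) \<omega>
    - trawl_overlap a (real (l n) * \<Delta> n)) / real n) \<in> borel_measurable M"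
      by (intro borel_measurable_divide borel_measurable_sum borel_measurable_diff borel_measurable_times
          L4_measurable[OF centred_trawl_in_L4] borel_measurable_const)
    have "AE \<omega> in M. \<forall>k\<in>{..<N n}. centred (U n k) \<omega> * centred (V n k) \<omega> =
      ((centred (U n k \<union> V n k) \<omega>)\<^sup>2 + (centred (U n k \<inter> V n k) \<omega>)\<^sup>2
        - (centred (U n k - V n k) \<omega>)\<^sup>2 - (centred (V n k - U n k) \<omega>)\<^sup>2) / 2"
      by (intro AE_finite_allI centred_mult_polarization U V) simp
    then show "AE \<omega> in M. (\<Sum>k<N n. (S (U n k \<union> V n k) \<omega> + S (U n k \<inter> V n k) \<omega>
      - S (U n k - V n k) \<omega> - S (V n k - U n k) \<omega>) / 2) / real n
      = (\<Sum>k<N n. centred_trawl (real (l n + k) * \<Delta> n) \<omega> * centred_trawl (real k * \<Delta> n) \<omega>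
    - trawl_overlap a (real (l n) * \<Delta> n)) / real n"
    proof eventually_elim
      case (elim \<omega>)
      have "(S (U n k \<union> V n k) \<omega> + S (U n k \<inter> V n k) \<omega> - S (U n k - V n k) \<omega> - S (V n k - U n k) \<omega>) / 2
        = centred_trawl (real (l n + k) * \<Delta> n) \<omega> * centred_trawl (real k * \<Delta> n) \<omega>
          - trawl_overlap a (real (l n) * \<Delta> n)" if "k < N n" for k
      proof -
        let ?m = "measure lborel :: _ \<Rightarrow> real"
        have "?m (U n k \<union> V n k) + ?m (U n k \<inter> V n k) - ?m (U n k - V n k) - ?m (V n k - U n k)
            = 2 * ?m (U n k \<inter> V n k)"
        proof -
          have "?m (U n k \<union> (V n k - U n k)) = ?m (U n k) + ?m (V n k - U n k)"
            by (intro measure_disjoint_Un finite_borel_Diff U V) auto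
          moreover have "?m ((U n k - V n k) \<union> (U n k \<inter> V n k)) = ?m (U n k - V n k) + ?m (U n k \<inter> V n k)"
            by (intro measure_disjoint_Un finite_borel_Diff finite_borel_Int U V) auto
          ultimately show ?thesis by (simp add: Un_Diff_Int)
        qed
        moreover have "centred (U n k) \<omega> * centred (V n k) \<omega> =
          ((centred (U n k \<union> V n k) \<omega>)\<^sup>2 + (centred (U n k \<inter> V n k) \<omega>)\<^sup>2
            - (centred (U n k - V n k) \<omega>)\<^sup>2 - (centred (V n k - U n k) \<omega>)\<^sup>2) / 2"
          using elim that by blast
        moreover have "centred_trawl (real (l n + k) * \<Delta> n) \<omega> * centred_trawl (real k * \<Delta> n) \<omega>
            = centred (U n k) \<omega> * centred (V n k) \<omega>"
          by (simp add: centred_trawl_def U_def V_def mult.commute)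
        ultimately show ?thesis
          using UV[of n k] unfolding S_def by (simp add: field_simps)
      qed
      then show ?case by (intro arg_cong[where f = "\<lambda>x. x / real n"] sum.cong) auto
    qed
  qed
qed

end

section \<open>The estimators as sample autocovariances\<close>

lemma sample_mean_eq: "sample_mean Y \<delta> n \<omega> = (\<Sum>k<n. Y (real k * \<delta>) \<omega>) / real n"
  by (simp add: sample_mean_def sum.atLeast1_atMost_eq)

lemma sample_mean_shift:
  "0 < n \<Longrightarrow> sample_mean (\<lambda>t \<omega>. Y t \<omega> + m) \<delta> n \<omega> = sample_mean Y \<delta> n \<omega> + m"
  by (simp add: sample_mean_eq sum.distrib add_divide_distrib)

text \<open>Since the estimators only see differences to the sample mean, the observed process may be replaced
  by its centred version.\<close>

lemma sample_autocov_shift: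
  "sample_autocov (\<lambda>t \<omega>. Y t \<omega> + m) \<delta> n l \<omega> = sample_autocov Y \<delta> n l \<omega>"
  by (cases "n = 0") (simp_all add: sample_autocov_def sample_mean_shift)

lemma trawl_estimator_shift:
  "trawl_estimator (\<lambda>t \<omega>. Y t \<omega> + m) \<delta> n t \<omega> = trawl_estimator Y \<delta> n t \<omega>"
  by (simp add: trawl_estimator_def sample_autocov_shift)

lemma leb_trawl_estimator_shift:
  "leb_trawl_estimator (\<lambda>t \<omega>. Y t \<omega> + m) = leb_trawl_estimator Y"
  by (intro ext) (simp add: leb_trawl_estimator_def trawl_estimator_shift)

lemma leb_inter_estimator_shift:
  "leb_inter_estimator (\<lambda>t \<omega>. Y t \<omega> + m) = leb_inter_estimator Y"
  by (intro ext) (simp add: leb_inter_estimator_def trawl_estimator_shift)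

lemma sample_autocov_beyond: "n \<le> l \<Longrightarrow> sample_autocov Y \<delta> n l \<omega> = 0"
  by (simp add: sample_autocov_def)

lemma sample_autocov_expand:
  "sample_autocov Y \<delta> n l \<omega> =
    (\<Sum>k<n - l. Y (real (l + k) * \<delta>) \<omega> * Y (real k * \<delta>) \<omega>) / real n
    - sample_mean Y \<delta> n \<omega> * ((\<Sum>k<n - l. Y (real (l + k) * \<delta>) \<omega>) / real n)
    - sample_mean Y \<delta> n \<omega> * ((\<Sum>k<n - l. Y (real k * \<delta>) \<omega>) / real n)
    + sample_mean Y \<delta> n \<omega> * (real (n - l) / real n * sample_mean Y \<delta> n \<omega>)"
proof -
  let ?m = "sample_mean Y \<delta> n \<omega>" and ?y = "\<lambda>k. Y (real k * \<delta>) \<omega>"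
  have "(\<Sum>k<n - l. (?y (l + k) - ?m) * (?y k - ?m))
      = (\<Sum>k<n - l. ?y (l + k) * ?y k - ?m * ?y (l + k) - ?m * ?y k + ?m * ?m)"
    by (intro sum.cong refl) (simp add: algebra_simps)
  also have "\<dots> = (\<Sum>k<n - l. ?y (l + k) * ?y k) - ?m * (\<Sum>k<n - l. ?y (l + k))
      - ?m * (\<Sum>k<n - l. ?y k) + ?m * (real (n - l) * ?m)"
    by (simp only: sum.distrib sum_subtractf sum_distrib_left[symmetric] sum_constant card_lessThan
        mult.left_commute)
  finally show ?thesis
    unfolding sample_autocov_def by (simp add: add_divide_distrib diff_divide_distrib)
qed

lemma trawl_estimator_grid:
  assumes "0 < \<delta>" "1 \<le> l"
  shows "trawl_estimator Y \<delta> n (real l * \<delta>) \<omega> * \<delta> = sample_autocov Y \<delta> n l \<omega> - sample_autocov Y \<delta> n (Suc l) \<omega>"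
  using assms by (simp add: trawl_estimator_def field_simps)

text \<open>At positive grid points the estimator is a difference quotient of the sample autocovariance, so the
  sum telescopes; its upper end vanishes because no pair of observations has lag \<open>n\<close>.\<close>

lemma sum_trawl_estimator:
  assumes "0 < \<delta>" "1 \<le> l"
  shows "(\<Sum>i=l..<n. trawl_estimator Y \<delta> n (real i * \<delta>) \<omega> * \<delta>) = sample_autocov Y \<delta> n l \<omega>"
proof (cases "l \<le> n")
  case True
  have "(\<Sum>i=l..<n. trawl_estimator Y \<delta> n (real i * \<delta>) \<omega> * \<delta>)
      = - (\<Sum>i=l..<n. sample_autocov Y \<delta> n (Suc i) \<omega> - sample_autocov Y \<delta> n i \<omega>)"
    using assms unfolding sum_negf[symmetric]
    by (intro sum.cong refl) (simp add: trawl_estimator_grid)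
  also have "\<dots> = sample_autocov Y \<delta> n l \<omega> - sample_autocov Y \<delta> n n \<omega>"
    using sum_Suc_diff'[OF True, of "\<lambda>i. sample_autocov Y \<delta> n i \<omega>"] by simp
  finally show ?thesis by (simp add: sample_autocov_beyond)
next
  case False
  then show ?thesis by (simp add: sample_autocov_beyond)
qed

lemma leb_inter_estimator_eq:
  assumes "0 < \<delta>" "0 < h"
  shows "leb_inter_estimator Y h \<delta> n \<omega> = sample_autocov Y \<delta> n (nat \<lceil>h / \<delta>\<rceil>) \<omega>"
proof -
  have iff: "h \<le> real l * \<delta> \<longleftrightarrow> nat \<lceil>h / \<delta>\<rceil> \<le> l" for l
    using assms by (simp add: ceiling_le_iff nat_le_iff divide_le_eq)
  have "{l. l < n \<and> h \<le> real l * \<delta>} = {nat \<lceil>h / \<delta>\<rceil>..<n}"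
    by (intro set_eqI) (simp only: iff mem_Collect_eq atLeastLessThan_iff conj_commute)
  moreover have "1 \<le> nat \<lceil>h / \<delta>\<rceil>"
    using assms by (simp add: Suc_le_eq)
  ultimately show ?thesis
    unfolding leb_inter_estimator_def using sum_trawl_estimator[OF assms(1)] by simp
qed

lemma sum_squared_increments:
  fixes z :: "nat \<Rightarrow> real"
  shows "(\<Sum>k<m. (z (Suc k) - z k)\<^sup>2)
    = 2 * (\<Sum>k<Suc m. z k * z k) - 2 * (\<Sum>k<m. z (Suc k) * z k) - (z 0)\<^sup>2 - (z m)\<^sup>2"
  by (induction m) (simp_all add: power2_eq_square algebra_simps)

text \<open>The estimator of \<open>a 0\<close> deviates from the forward difference of the sample autocovariance only
  by two boundary terms.\<close>

lemma leb_trawl_estimator_eq: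
  assumes "0 < \<delta>"
  shows "leb_trawl_estimator Y \<delta> n \<omega> = sample_autocov Y \<delta> n 0 \<omega>
    - ((Y 0 \<omega> - sample_mean Y \<delta> n \<omega>)\<^sup>2 + (Y (real (n - 1) * \<delta>) \<omega> - sample_mean Y \<delta> n \<omega>)\<^sup>2) / (2 * real n)"
proof (cases n)
  case 0
  then show ?thesis by (simp add: leb_trawl_estimator_def sample_autocov_def)
next
  case (Suc m)
  define z where "z k = Y (real k * \<delta>) \<omega> - sample_mean Y \<delta> n \<omega>" for k
  have "leb_trawl_estimator Y \<delta> n \<omega> = trawl_estimator Y \<delta> n 0 \<omega> * \<delta>
      + (\<Sum>l=1..<n. trawl_estimator Y \<delta> n (real l * \<delta>) \<omega> * \<delta>)"
    unfolding leb_trawl_estimator_def using Suc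
    by (simp add: lessThan_atLeast0 sum.atLeast_Suc_lessThan)
  also have "(\<Sum>l=1..<n. trawl_estimator Y \<delta> n (real l * \<delta>) \<omega> * \<delta>) = sample_autocov Y \<delta> n 1 \<omega>"
    using sum_trawl_estimator[OF assms, of 1] by simp
  also have "\<dots> = (\<Sum>k<m. z (Suc k) * z k) / real n"
    using Suc by (simp add: sample_autocov_def z_def)
  also have "trawl_estimator Y \<delta> n 0 \<omega> * \<delta> = (\<Sum>k<m. (z (Suc k) - z k)\<^sup>2) / (2 * real n)"
  proof -
    have "(\<Sum>k<m. (z (Suc k) - z k)\<^sup>2)
        = (\<Sum>k<n - 1. (Y (real (k + 1) * \<delta>) \<omega> - Y (real k * \<delta>) \<omega>)\<^sup>2)"
      using Suc by (simp add: z_def)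
    then show ?thesis
      using assms by (simp only: trawl_estimator_def if_True refl) simp
  qed
  also have "\<dots> + (\<Sum>k<m. z (Suc k) * z k) / real n
      = (\<Sum>k<Suc m. z k * z k) / real n - ((z 0)\<^sup>2 + (z m)\<^sup>2) / (2 * real n)"
    unfolding sum_squared_increments using Suc by (simp add: field_simps)
  also have "(\<Sum>k<Suc m. z k * z k) / real n = sample_autocov Y \<delta> n 0 \<omega>"
    using Suc by (simp add: sample_autocov_def z_def)
  finally show ?thesis using Suc by (simp add: z_def)
qed

lemma leb_diff_estimator_eq:
  "leb_diff_estimator Y h \<delta> n \<omega> = leb_trawl_estimator Y \<delta> n \<omega> - leb_inter_estimator Y h \<delta> n \<omega>"
proof -
  let ?D = "{l. l < n \<and> real l * \<delta> < h}" and ?I = "{l. l < n \<and> h \<le> real l * \<delta>}"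
  have "{..<n} = ?D \<union> ?I" "?D \<inter> ?I = {}" "finite ?D" "finite ?I" by auto
  then show ?thesis
    unfolding leb_diff_estimator_def leb_trawl_estimator_def leb_inter_estimator_def
    by (simp add: sum.union_disjoint)
qed

section \<open>Consistency\<close>

context sampled_trawl
begin

lemma sample_mean_measurable: "sample_mean centred_trawl (\<Delta> n) n \<in> borel_measurable M"
  using average_measurable[of "\<lambda>k. real k * \<Delta> n" n "real n"] by (simp add: sample_mean_eq[abs_def])

lemma sample_mean_square_integrable: "integrable M (\<lambda>\<omega>. (sample_mean centred_trawl (\<Delta> n) n \<omega>)\<^sup>2)"
  using average_square_integrable[of "\<lambda>k. real k * \<Delta> n" n "real n"] by (simp add: sample_mean_eq)

lemma sample_mean_tendsto_L2:
  "(\<lambda>n. expectation (\<lambda>\<omega>. (sample_mean centred_trawl (\<Delta> n) n \<omega>)\<^sup>2)) \<longlonglongrightarrow> 0"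
  using average_tendsto_L2[of "\<lambda>n. n" "\<lambda>_. 0"] by (simp add: sample_mean_eq)

text \<open>Of the four terms of the expanded sample autocovariance, the average product converges to the
  overlap, and each of the others is a product of the sample mean with a further quantity that
  vanishes in \<open>L\<^sup>2\<close>.\<close>

lemma sample_autocov_tendsto_L1:
  assumes lag: "(\<lambda>n. real (l n) * \<Delta> n) \<longlonglongrightarrow> s"
  shows "tendsto_L1 (\<lambda>n. sample_autocov centred_trawl (\<Delta> n) n (l n)) (trawl_overlap a s)"
proof -
  let ?m = "\<lambda>n. sample_mean centred_trawl (\<Delta> n) n" and ?N = "\<lambda>n. n - l n"
  obtain H where H: "\<And>n. real (l n) * \<Delta> n \<le> H"
    using convergent_imp_Bseq[OF convergentI[OF lag]] unfolding Bseq_def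
    by (metis abs_le_iff real_norm_def)
  have ratio: "(\<lambda>n. real (?N n) / real n) \<longlonglongrightarrow> 1"
  proof -
    have "(\<lambda>n. (real (l n) * \<Delta> n) * inverse (real n * \<Delta> n)) \<longlonglongrightarrow> s * 0"
      by (intro tendsto_mult lag tendsto_inverse_0_at_top[OF long_range])
    then have "(\<lambda>n. 1 - (real (l n) * \<Delta> n) * inverse (real n * \<Delta> n)) \<longlonglongrightarrow> 1 - 0"
      by (intro tendsto_diff tendsto_const) simp
    moreover have "(real (l n) * \<Delta> n) * inverse (real n * \<Delta> n) = real (l n) / real n" for n
      using width_pos[of n] by (simp add: divide_simps)
    ultimately have low: "(\<lambda>n. 1 - real (l n) / real n) \<longlonglongrightarrow> 1" by simp
    show ?thesis
    proof (rule tendsto_sandwich[OF _ _ low tendsto_const])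
      show "eventually (\<lambda>n. 1 - real (l n) / real n \<le> real (?N n) / real n) sequentially"
        using eventually_gt_at_top[of 0]
      proof eventually_elim
        case (elim n)
        have "(real n - real (l n)) / real n \<le> real (?N n) / real n"
          by (intro divide_right_mono) linarith+
        then show ?case using elim by (simp add: diff_divide_distrib)
      qed
      show "eventually (\<lambda>n. real (?N n) / real n \<le> 1) sequentially"
        using eventually_gt_at_top[of 0] by eventually_elim simp
    qed
  qed
  define P where "P n \<omega> = (\<Sum>k<?N n. centred_trawl (real (l n + k) * \<Delta> n) \<omega> * centred_trawl (real k * \<Delta> n) \<omega>
    - trawl_overlap a (real (l n) * \<Delta> n)) / real n" for n \<omega>
  have P: "tendsto_L1 P 0"
    unfolding P_def by (intro products_average_tendsto_L1[OF _ H]) simp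
  have D: "tendsto_L1 (\<lambda>n \<omega>. real (?N n) / real n * trawl_overlap a (real (l n) * \<Delta> n)) (1 * trawl_overlap a s)"
    using width_pos lag
    by (intro tendsto_L1_deterministic tendsto_mult ratio trawl_overlap_tendsto[OF trawl])
      (auto simp: less_imp_le)
  have W1: "tendsto_L1 (\<lambda>n \<omega>. ?m n \<omega> * ((\<Sum>k<?N n. centred_trawl (real (l n + k) * \<Delta> n) \<omega>) / real n)) 0"
    by (intro tendsto_L1_zero_mult sample_mean_measurable average_measurable sample_mean_square_integrable
        average_square_integrable sample_mean_tendsto_L2 average_tendsto_L2) simp
  have W2: "tendsto_L1 (\<lambda>n \<omega>. ?m n \<omega> * ((\<Sum>k<?N n. centred_trawl (real k * \<Delta> n) \<omega>) / real n)) 0"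
    using average_tendsto_L2[of ?N "\<lambda>_. 0"]
    by (intro tendsto_L1_zero_mult sample_mean_measurable average_measurable sample_mean_square_integrable
        average_square_integrable sample_mean_tendsto_L2) simp
  have W3: "tendsto_L1 (\<lambda>n \<omega>. ?m n \<omega> * (real (?N n) / real n * ?m n \<omega>)) 0"
  proof (intro tendsto_L1_zero_mult sample_mean_measurable sample_mean_square_integrable sample_mean_tendsto_L2)
    show "(\<lambda>\<omega>. real (?N n) / real n * ?m n \<omega>) \<in> borel_measurable M" for n
      using sample_mean_measurable[of n] by simp
    show "integrable M (\<lambda>\<omega>. (real (?N n) / real n * ?m n \<omega>)\<^sup>2)" for n
      unfolding power_mult_distrib by (intro integrable_mult_right sample_mean_square_integrable)
    have "(\<lambda>n. (real (?N n) / real n)\<^sup>2 * expectation (\<lambda>\<omega>. (?m n \<omega>)\<^sup>2)) \<longlonglongrightarrow> 1\<^sup>2 * 0"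
      by (intro tendsto_mult tendsto_power ratio sample_mean_tendsto_L2)
    then show "(\<lambda>n. expectation (\<lambda>\<omega>. (real (?N n) / real n * ?m n \<omega>)\<^sup>2)) \<longlonglongrightarrow> 0"
      unfolding power_mult_distrib by simp
  qed
  have "tendsto_L1 (\<lambda>n \<omega>. P n \<omega> + real (?N n) / real n * trawl_overlap a (real (l n) * \<Delta> n)
      - ?m n \<omega> * ((\<Sum>k<?N n. centred_trawl (real (l n + k) * \<Delta> n) \<omega>) / real n)
      - ?m n \<omega> * ((\<Sum>k<?N n. centred_trawl (real k * \<Delta> n) \<omega>) / real n)
      + ?m n \<omega> * (real (?N n) / real n * ?m n \<omega>)) (0 + 1 * trawl_overlap a s - 0 - 0 + 0)"
    by (intro tendsto_L1_add[OF tendsto_L1_diff[OF tendsto_L1_diff[OF tendsto_L1_add[OF P D] W1] W2] W3])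
  moreover have "P n \<omega> + real (?N n) / real n * trawl_overlap a (real (l n) * \<Delta> n)
     = (\<Sum>k<?N n. centred_trawl (real (l n + k) * \<Delta> n) \<omega> * centred_trawl (real k * \<Delta> n) \<omega>) / real n" for n \<omega>
    by (simp add: P_def sum_subtractf diff_divide_distrib)
  ultimately show ?thesis
    by (simp add: sample_autocov_expand[abs_def])
qed

text \<open>Each boundary term has a bounded second moment and is divided by \<open>n\<close>.\<close>

lemma boundary_tendsto_L1:
  "tendsto_L1 (\<lambda>n \<omega>. ((centred_trawl 0 \<omega> - sample_mean centred_trawl (\<Delta> n) n \<omega>)\<^sup>2
    + (centred_trawl (real (n - 1) * \<Delta> n) \<omega> - sample_mean centred_trawl (\<Delta> n) n \<omega>)\<^sup>2) / (2 * real n)) 0"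
proof (rule tendsto_L1_zeroI)
  let ?c = "\<lambda>n. centred_trawl (real (n - 1) * \<Delta> n)" and ?m = "\<lambda>n. sample_mean centred_trawl (\<Delta> n) n"
  have c: "integrable M (\<lambda>\<omega>. (centred_trawl t \<omega>)\<^sup>2)" "expectation (\<lambda>\<omega>. (centred_trawl t \<omega>)\<^sup>2) = trawl_overlap a 0" for t
    using L4_integrable_square[OF centred_trawl_in_L4] finite_borel_trawl_set_at[OF trawl]
    by (simp_all add: centred_trawl_def expectation_centred_square measure_trawl_set_at[OF trawl])
  show "(\<lambda>\<omega>. ((centred_trawl 0 \<omega> - ?m n \<omega>)\<^sup>2 + (?c n \<omega> - ?m n \<omega>)\<^sup>2) / (2 * real n)) \<in> borel_measurable M" for n
    by (intro borel_measurable_divide borel_measurable_add borel_measurable_power borel_measurable_diff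
        L4_measurable[OF centred_trawl_in_L4] sample_mean_measurable borel_measurable_const)
  let ?V = "\<lambda>n \<omega>. ((centred_trawl 0 \<omega>)\<^sup>2 + (?c n \<omega>)\<^sup>2 + 2 * (?m n \<omega>)\<^sup>2) / real n"
  show "integrable M (?V n)" for n
    using c sample_mean_square_integrable by simp
  show "\<bar>((centred_trawl 0 \<omega> - ?m n \<omega>)\<^sup>2 + (?c n \<omega> - ?m n \<omega>)\<^sup>2) / (2 * real n)\<bar> \<le> ?V n \<omega>" for n \<omega>
  proof -
    have sq: "(x - y)\<^sup>2 \<le> 2 * x\<^sup>2 + 2 * y\<^sup>2" for x y :: real
      using zero_le_power2[of "x + y"] by (simp add: power2_sum power2_diff)
    have "((centred_trawl 0 \<omega> - ?m n \<omega>)\<^sup>2 + (?c n \<omega> - ?m n \<omega>)\<^sup>2) / (2 * real n)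
        \<le> (2 * ((centred_trawl 0 \<omega>)\<^sup>2 + (?c n \<omega>)\<^sup>2 + 2 * (?m n \<omega>)\<^sup>2)) / (2 * real n)"
      using sq[of "centred_trawl 0 \<omega>" "?m n \<omega>"] sq[of "?c n \<omega>" "?m n \<omega>"]
      by (intro divide_right_mono) auto
    also have "\<dots> = ?V n \<omega>" by (rule mult_divide_mult_cancel_left) simp
    finally show ?thesis by simp
  qed
  have "expectation (?V n) = (2 * trawl_overlap a 0 + 2 * expectation (\<lambda>\<omega>. (?m n \<omega>)\<^sup>2)) * inverse (real n)" for n
    using c sample_mean_square_integrable[of n] by (simp add: divide_inverse)
  moreover have "(\<lambda>n. (2 * trawl_overlap a 0 + 2 * expectation (\<lambda>\<omega>. (?m n \<omega>)\<^sup>2)) * inverse (real n))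
      \<longlonglongrightarrow> (2 * trawl_overlap a 0 + 2 * 0) * 0"
    by (intro tendsto_intros sample_mean_tendsto_L2 lim_inverse_n)
  ultimately show "(\<lambda>n. expectation (?V n)) \<longlonglongrightarrow> 0" by simp
qed

lemma leb_trawl_estimator_tendsto_L1:
  "tendsto_L1 (\<lambda>n. leb_trawl_estimator (trawl_process L a) (\<Delta> n) n) (trawl_overlap a 0)"
proof -
  have "tendsto_L1 (\<lambda>n \<omega>. sample_autocov centred_trawl (\<Delta> n) n 0 \<omega>
     - ((centred_trawl 0 \<omega> - sample_mean centred_trawl (\<Delta> n) n \<omega>)\<^sup>2
       + (centred_trawl (real (n - 1) * \<Delta> n) \<omega> - sample_mean centred_trawl (\<Delta> n) n \<omega>)\<^sup>2) / (2 * real n))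
     (trawl_overlap a 0 - 0)"
    using sample_autocov_tendsto_L1[of "\<lambda>_. 0" 0] by (intro tendsto_L1_diff boundary_tendsto_L1) simp
  then show ?thesis
    unfolding leb_trawl_estimator_eq[OF width_pos, symmetric] trawl_process_eq leb_trawl_estimator_shift
    by simp
qed

lemma leb_inter_estimator_tendsto_L1:
  assumes "0 < h"
  shows "tendsto_L1 (\<lambda>n. leb_inter_estimator (trawl_process L a) h (\<Delta> n) n) (trawl_overlap a h)"
proof -
  have lag: "(\<lambda>n. real (nat \<lceil>h / \<Delta> n\<rceil>) * \<Delta> n) \<longlonglongrightarrow> h"
  proof (rule tendsto_sandwich[OF _ _ tendsto_const])
    have "(\<lambda>n. h + \<Delta> n) \<longlonglongrightarrow> h + 0"
      by (intro tendsto_add tendsto_const width_lim)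
    then show "(\<lambda>n. h + \<Delta> n) \<longlonglongrightarrow> h" by simp
    have *: "h / \<Delta> n \<le> real (nat \<lceil>h / \<Delta> n\<rceil>)" "real (nat \<lceil>h / \<Delta> n\<rceil>) \<le> h / \<Delta> n + 1" for n
      using assms width_pos[of n] by (auto simp: real_nat_ceiling_ge) 
    show "eventually (\<lambda>n. h \<le> real (nat \<lceil>h / \<Delta> n\<rceil>) * \<Delta> n) sequentially"
      using *(1) width_pos by (intro always_eventually) (simp add: field_simps)
    show "eventually (\<lambda>n. real (nat \<lceil>h / \<Delta> n\<rceil>) * \<Delta> n \<le> h + \<Delta> n) sequentially"
    proof (intro always_eventually allI)
      fix n
      have "real (nat \<lceil>h / \<Delta> n\<rceil>) * \<Delta> n \<le> (h / \<Delta> n + 1) * \<Delta> n"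
        using width_pos[of n] *(2)[of n] by (intro mult_right_mono) auto
      then show "real (nat \<lceil>h / \<Delta> n\<rceil>) * \<Delta> n \<le> h + \<Delta> n"
        using width_pos[of n] by (simp add: distrib_right)
    qed
  qed
  show ?thesis
    using sample_autocov_tendsto_L1[OF lag]
    unfolding trawl_process_eq leb_inter_estimator_shift leb_inter_estimator_eq[OF width_pos assms, symmetric] .
qed

end

theorem proposition3:
  fixes M :: "'a measure" and L :: "(real \<times> real) set \<Rightarrow> 'a \<Rightarrow> real"
    and M' :: "'b measure" and L' :: "'b \<Rightarrow> real"
    and \<gamma> b :: real and \<nu> :: "real measure"
    and a :: "real \<Rightarrow> real" and X :: "real \<Rightarrow> 'a \<Rightarrow> real"
    and \<Delta> :: "nat \<Rightarrow> real" and h :: real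
  assumes "homogeneous_levy_basis M L \<gamma> b \<nu>"
    and "levy_seed M' L' \<gamma> b \<nu>"
    and "trawl_function a"
    and "X = trawl_process L a"
    and "\<And>n. 0 < \<Delta> n"
    and "\<Delta> \<longlonglongrightarrow> 0"
    and "filterlim (\<lambda>n. real n * \<Delta> n) at_top sequentially"
    and "integrable M' (\<lambda>\<omega>. \<bar>L' \<omega>\<bar> ^ 4)"
    and "prob_space.variance M' L' = 1"
    and "0 < h"
  shows "tendsto_in_prob M (\<lambda>n. leb_trawl_estimator X (\<Delta> n) n)
           (measure lborel (trawl_set a)) \<and>
         tendsto_in_prob M (\<lambda>n. leb_inter_estimator X h (\<Delta> n) n)
           (measure lborel (trawl_set a \<inter> trawl_set_at a h)) \<and>
         tendsto_in_prob M (\<lambda>n. leb_diff_estimator X h (\<Delta> n) n)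
           (measure lborel (trawl_set a - trawl_set_at a h))"
proof -
  interpret sampled_trawl M L \<gamma> b \<nu> M' L' a \<Delta>
    by (intro sampled_trawl.intro normalized_levy_basis.intro normalized_levy_basis_axioms.intro
        sampled_trawl_axioms.intro assms)
  have A: "trawl_set_at a 0 = trawl_set a"
    by (simp add: trawl_set_at_def zero_prod_def[symmetric])
  have fin: "finite_borel (trawl_set a)" "finite_borel (trawl_set_at a h)"
    using finite_borel_trawl_set_at[OF trawl] by (auto simp flip: A)
  have total: "measure lborel (trawl_set a) = trawl_overlap a 0"
    using measure_trawl_set_at[OF trawl, of 0] by (simp add: A)
  have inter: "measure lborel (trawl_set a \<inter> trawl_set_at a h) = trawl_overlap a h"
    using measure_trawl_set_at_Int[OF trawl, of 0 h] \<open>0 < h\<close> by (simp add: A)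
  have "measure lborel ((trawl_set a - trawl_set_at a h) \<union> (trawl_set a \<inter> trawl_set_at a h))
      = measure lborel (trawl_set a - trawl_set_at a h) + measure lborel (trawl_set a \<inter> trawl_set_at a h)"
    by (intro measure_disjoint_Un finite_borel_Diff finite_borel_Int fin) auto
  then have diff: "measure lborel (trawl_set a - trawl_set_at a h) = trawl_overlap a 0 - trawl_overlap a h"
    by (simp add: total inter Un_Diff_Int)
  have X: "X = trawl_process L a" by fact
  note total_lim = leb_trawl_estimator_tendsto_L1 and inter_lim = leb_inter_estimator_tendsto_L1[OF \<open>0 < h\<close>]
  have "tendsto_L1 (\<lambda>n. leb_diff_estimator X h (\<Delta> n) n) (trawl_overlap a 0 - trawl_overlap a h)"
    unfolding X leb_diff_estimator_eq[abs_def] by (rule tendsto_L1_diff[OF total_lim inter_lim])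
  then show ?thesis
    unfolding total inter diff using total_lim inter_lim X by (simp add: tendsto_L1_imp_in_prob)
qed

end
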